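(* Let $\sigma:\mathbb{R}\to\mathbb{R}$ be an activation function representable by a compositional tensor with $L_\sigma$ layers, width $p_\sigma$, $m_\sigma$ non-zero parameters, lift $\mathfrak{L}_\sigma(x)=(x,0,\dots,0)$, retraction $\mathfrak{R}_\sigma(y)=y_1$, and with univariate basis $\Phi$ such that $\{1,x\}\subseteq\Phi$. Let $f=T_L\circ\sigma\circ T_{L-1}\circ\sigma\circ\dots\circ\sigma\circ T_1$ be a deep neural network of width $p_f\ge d,d_o$, with $\sigma$ acting componentwise and affine transformations $T_\ell(z)=A_\ell z+b_\ell$, where $T_1:\mathbb{R}^d\to\mathbb{R}^{p_f}$, $T_\ell:\mathbb{R}^{p_f}\to\mathbb{R}^{p_f}$ for $2\le\ell\le L-1$, and $T_L:\mathbb{R}^{p_f}\to\mathbb{R}^{d_o}$. Then $f$ can be exactly encoded by a compositional tensor with basis $\Phi$, with $L+(L-1)L_\sigma$ layers, width $p:=p_f\cdot p_\sigma$, and lift $\mathfrak{L}:\mathbb{R}^d\to\mathbb{R}^{p_fp_\sigma}$ and retraction $\mathfrak{R}:\mathbb{R}^{p_fp_\sigma}\to\mathbb{R}^{d_o}$ given, with coordinates of $\mathbb{R}^{p_fp_\sigma}$ indexed by pairs $(i,k)$, $1\le i\le p_f$, $1\le k\le p_\sigma$, by $$\mathfrak{L}(x)_{i,k}=\begin{cases}x_i & \text{if } 1\le i\le d \text{ and } k=1,\\ 0&\text{otherwise,}\end{cases}\qquad \mathfrak{R}(y)=(y_{1,1},\dots,y_{d_o,1}).$$ Moreover, the number of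 non-zero parameters of this encoding is $$\sum_{\ell=1}^{L-1}\big(\|A_\ell-I\|_0+\|b_\ell\|_0\big)+\big(\|A_L-I\|_0+\|b_L\|_0\big)+(L-1)p_fm_\sigma .$$ Suppose that the $L_\sigma$ layers of $\sigma$ have TT ranks bounded by $\boldsymbol r_\sigma$. Then the TT ranks of each layer encoding an affine transformation are bounded by $(p,p_f,\dots,p_f)$, and the TT ranks of the layers computing $\sigma$ are bounded by $\boldsymbol r_\sigma$. If $\sigma\in\operatorname{span}\Phi$, then $p_\sigma=1$, $m_\sigma=1$, $L_\sigma=1$ and $\mathfrak{L}_\sigma(x)=x$, which results in an encoding of $f$ by a compositional tensor with $2L-1$ layers, with width $p_f$, and with TT ranks bounded by $(p,p_f,\dots,p_f)$.
   Context: Compositional tensors. Let $\Phi=\{\phi_1,\dots,\phi_n\}$ be a finite set of functions $\mathbb{R}\to\mathbb{R}$ (the univariate basis). Given linear maps $\mathfrak{L}:\mathbb{R}^d\to\mathbb{R}^p$ (lift) and $\mathfrak{R}:\mathbb{R}^p\to\mathbb{R}^{d_o}$ (retraction), a function $v:\mathbb{R}^d\to\mathbb{R}^{d_o}$ is a compositional tensor with $L$ layers, width $p$ and basis $\Phi$ if $$v=\mathfrak{R}\circ(\mathrm{Id}+\psi_L)\circ\dots\circ(\mathrm{Id}+\psi_1)\circ\mathfrak{L},$$ where each layer $\psi_k:\mathbb{R}^p\to\mathbb{R}^p$ has the form $\psi_k(x)_j=\sum_{i_1,\dots,i_p=1}^n\boldsymbol\psi_k(j,i_1,\dots,i_p)\phi_{i_1}(x_1)\cdots\phi_{i_p}(x_p)$,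 $1\le j\le p$, with coefficient tensor $\boldsymbol\psi_k\in\mathbb{R}^{p\times n\times\dots\times n}$. Number of non-zero parameters: the total number of non-zero entries of the coefficient tensors $\boldsymbol\psi_1,\dots,\boldsymbol\psi_L$. TT ranks: $\psi_k$ has TT ranks bounded by $(r_0,r_1,\dots,r_{p-1})$, with $r_0=p$ and $r_p=1$, if there are matrix-valued functions $U_i:\mathbb{R}\to\mathbb{R}^{r_{i-1}\times r_i}$, $1\le i\le p$, with entries in $\operatorname{span}\Phi$, such that $\psi_k(x)=U_1(x_1)\cdots U_p(x_p)$. For the layers of width $p_fp_\sigma$ computing $\sigma$ in parallel, the bound by $\boldsymbol r_\sigma$ is read block by block: inside each block of $p_\sigma$ coordinates $(i,1),\dots,(i,p_\sigma)$, the TT ranks are bounded by the corresponding entries of $\boldsymbol r_\sigma$. $\|\cdot\|_0$ is the number of non-zero entries of a matrix or vector. $I$ is the identity matrix of the shape of $A_\ell$ (ones on the main diagonal, zeros elsewhere).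
   Formalization: The parameter count and the affine-layer TT ranks are claimed only if σ's layers, run L−1 times with only the first coordinate overwritten in between, return σ each time; m_σ=1 is claimed only if σ(x)−x=cφ(x) with φ∈Φ, c≠0. *)

theory Defs
  imports Complex_Main "HOL-Library.FuncSet" "Jordan_Normal_Form.Matrix"
begin

text \<open>Points of \<open>\<real>\<^sup>n\<close> are elements of \<open>carrier_vec n\<close>; coordinates are counted from 0.\<close>

section \<open>Compositional tensors\<close>

definition fun_span :: "(real \<Rightarrow> real) set \<Rightarrow> (real \<Rightarrow> real) set" where
  "fun_span \<Phi> = {f. \<exists>c. \<forall>t. f t = (\<Sum>\<phi>\<in>\<Phi>. c \<phi> * \<phi> t)}"

text \<open>
  The multi-indices \<open>(i\<^sub>1, \<dots>, i\<^sub>p)\<close> are encoded by the selected basis functions themselves, that is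
  by the tuples \<open>(\<phi>\<^sub>i\<^sub>1, \<dots>, \<phi>\<^sub>i\<^sub>p)\<close> in \<open>\<Phi>\<^sup>p\<close>. Values of a coefficient tensor outside
  \<open>j < p\<close>, \<open>\<mu> \<in> multi_indices \<Phi> p\<close> are irrelevant.
\<close>

definition multi_indices :: "(real \<Rightarrow> real) set \<Rightarrow> nat \<Rightarrow> (nat \<Rightarrow> real \<Rightarrow> real) set" where
  "multi_indices \<Phi> p = {..<p} \<rightarrow>\<^sub>E \<Phi>"

type_synonym coeff_tensor = "nat \<Rightarrow> (nat \<Rightarrow> real \<Rightarrow> real) \<Rightarrow> real"

definition ct_layer :: "(real \<Rightarrow> real) set \<Rightarrow> nat \<Rightarrow> coeff_tensor \<Rightarrow> real vec \<Rightarrow> real vec" where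
  "ct_layer \<Phi> p C x =
     vec p (\<lambda>j. \<Sum>\<mu>\<in>multi_indices \<Phi> p. C j \<mu> * (\<Prod>k<p. \<mu> k (x $ k)))"

definition num_params :: "(real \<Rightarrow> real) set \<Rightarrow> nat \<Rightarrow> coeff_tensor \<Rightarrow> nat" where
  "num_params \<Phi> p C = card {(j, \<mu>). j < p \<and> \<mu> \<in> multi_indices \<Phi> p \<and> C j \<mu> \<noteq> 0}"

text \<open>The head of the list is the layer that is applied first.\<close>

definition ct_run :: "(real \<Rightarrow> real) set \<Rightarrow> nat \<Rightarrow> coeff_tensor list \<Rightarrow> real vec \<Rightarrow> real vec" where
  "ct_run \<Phi> p Cs x = fold (\<lambda>C y. y + ct_layer \<Phi> p C y) Cs x"

definition total_params :: "(real \<Rightarrow> real) set \<Rightarrow> nat \<Rightarrow> coeff_tensor list \<Rightarrow> nat" where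
  "total_params \<Phi> p Cs = (\<Sum>C\<leftarrow>Cs. num_params \<Phi> p C)"

definition linear_vec_map :: "nat \<Rightarrow> nat \<Rightarrow> (real vec \<Rightarrow> real vec) \<Rightarrow> bool" where
  "linear_vec_map m n F \<longleftrightarrow>
     F \<in> carrier_vec m \<rightarrow> carrier_vec n \<and>
     (\<forall>x\<in>carrier_vec m. \<forall>y\<in>carrier_vec m. F (x + y) = F x + F y) \<and>
     (\<forall>c. \<forall>x\<in>carrier_vec m. F (c \<cdot>\<^sub>v x) = c \<cdot>\<^sub>v F x)"

text \<open>\<open>v : \<real>\<^sup>d \<rightarrow> \<real>\<^sup>d\<^sup>o\<close> is the compositional tensor with \<open>length Cs\<close> layers, width \<open>p\<close>, basis \<open>\<Phi>\<close>,
  the given lift and the given retraction.\<close>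

definition compositional_tensor ::
  "(real \<Rightarrow> real) set \<Rightarrow> nat \<Rightarrow> coeff_tensor list \<Rightarrow> (real vec \<Rightarrow> real vec) \<Rightarrow> (real vec \<Rightarrow> real vec)
     \<Rightarrow> nat \<Rightarrow> nat \<Rightarrow> (real vec \<Rightarrow> real vec) \<Rightarrow> bool" where
  "compositional_tensor \<Phi> p Cs lift retr d d_o v \<longleftrightarrow>
     linear_vec_map d p lift \<and> linear_vec_map p d_o retr \<and>
     (\<forall>x\<in>carrier_vec d. v x = retr (ct_run \<Phi> p Cs (lift x)))"

text \<open>The list \<open>r\<close> is \<open>(r\<^sub>0, \<dots>, r\<^bsub>p-1\<^esub>)\<close>; appending \<open>r\<^sub>p = 1\<close> makes the product a matrix with
  a single column.\<close>

definition tt_bounded ::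
  "(real \<Rightarrow> real) set \<Rightarrow> nat \<Rightarrow> nat list \<Rightarrow> (real vec \<Rightarrow> real vec) \<Rightarrow> bool" where
  "tt_bounded \<Phi> p r \<psi> \<longleftrightarrow>
     length r = p \<and> (r @ [1]) ! 0 = p \<and>
     (\<exists>U :: nat \<Rightarrow> real \<Rightarrow> real mat.
        (\<forall>i<p. \<forall>t. U i t \<in> carrier_mat ((r @ [1]) ! i) ((r @ [1]) ! Suc i)) \<and>
        (\<forall>i<p. \<forall>a<(r @ [1]) ! i. \<forall>c<(r @ [1]) ! Suc i. (\<lambda>t. U i t $$ (a, c)) \<in> fun_span \<Phi>) \<and>
        (\<forall>x\<in>carrier_vec p. \<psi> x = col (foldr (\<lambda>i M. U i (x $ i) * M) [0..<p] (1\<^sub>m 1)) 0))"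

section \<open>Deep neural networks\<close>

text \<open>\<open>T\<^sub>\<l>\<close> maps \<open>\<real>\<^bsup>nn_dim (\<l> - 1)\<^esup>\<close> to \<open>\<real>\<^bsup>nn_dim \<l>\<^esup>\<close>, \<open>1 \<le> \<l> \<le> L\<close>. For \<open>L = 1\<close> this
  gives a single affine map \<open>\<real>\<^sup>d \<rightarrow> \<real>\<^sup>d\<^sup>o\<close>.\<close>

definition nn_dim :: "nat \<Rightarrow> nat \<Rightarrow> nat \<Rightarrow> nat \<Rightarrow> nat \<Rightarrow> nat" where
  "nn_dim d p_f d_o L l = (if l = 0 then d else if l = L then d_o else p_f)"

primrec dnn ::
  "(real \<Rightarrow> real) \<Rightarrow> (nat \<Rightarrow> real mat) \<Rightarrow> (nat \<Rightarrow> real vec) \<Rightarrow> nat \<Rightarrow> real vec \<Rightarrow> real vec" where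
  "dnn \<sigma> A b 0 x = x"
| "dnn \<sigma> A b (Suc l) x =
     A (Suc l) *\<^sub>v (if l = 0 then x else map_vec \<sigma> (dnn \<sigma> A b l x)) + b (Suc l)"

definition eye :: "nat \<Rightarrow> nat \<Rightarrow> real mat" where
  "eye m n = mat m n (\<lambda>(i, j). if i = j then 1 else 0)"

definition nnz_mat :: "real mat \<Rightarrow> nat" where
  "nnz_mat M = card {(i, j). i < dim_row M \<and> j < dim_col M \<and> M $$ (i, j) \<noteq> 0}"

definition nnz_vec :: "real vec \<Rightarrow> nat" where
  "nnz_vec v = card {i. i < dim_vec v \<and> v $ i \<noteq> 0}"

definition affine_params :: "real mat \<Rightarrow> real vec \<Rightarrow> nat" where
  "affine_params A b = nnz_mat (A - eye (dim_row A) (dim_col A)) + nnz_vec b"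

section \<open>Lifts, retractions and blocks\<close>

definition act_lift :: "nat \<Rightarrow> real vec \<Rightarrow> real vec" where
  "act_lift p x = vec p (\<lambda>k. if k = 0 then x $ 0 else 0)"

definition act_retr :: "real vec \<Rightarrow> real vec" where
  "act_retr y = vec 1 (\<lambda>_. y $ 0)"

text \<open>The coordinate \<open>(i, k)\<close> of \<open>\<real>\<^bsup>p_f * p_s\<^esup>\<close>, with \<open>i < p_f\<close> and \<open>k < p_s\<close>, has number
  \<open>i * p_s + k\<close>; the coordinates of a block are consecutive.\<close>

definition pair_lift :: "nat \<Rightarrow> nat \<Rightarrow> nat \<Rightarrow> real vec \<Rightarrow> real vec" where
  "pair_lift p_f p_s d x =
     vec (p_f * p_s) (\<lambda>t. if t div p_s < d \<and> t mod p_s = 0 then x $ (t div p_s) else 0)"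

definition pair_retr :: "nat \<Rightarrow> nat \<Rightarrow> real vec \<Rightarrow> real vec" where
  "pair_retr p_s d_o y = vec d_o (\<lambda>i. y $ (i * p_s))"

definition block :: "nat \<Rightarrow> nat \<Rightarrow> real vec \<Rightarrow> real vec" where
  "block p_s i y = vec p_s (\<lambda>k. y $ (i * p_s + k))"

definition block_tt_bounded ::
  "(real \<Rightarrow> real) set \<Rightarrow> nat \<Rightarrow> nat \<Rightarrow> nat list \<Rightarrow> (real vec \<Rightarrow> real vec) \<Rightarrow> bool" where
  "block_tt_bounded \<Phi> p_f p_s r \<psi> \<longleftrightarrow>
     (\<forall>i<p_f. \<exists>\<psi>'. tt_bounded \<Phi> p_s r \<psi>' \<and>
        (\<forall>y\<in>carrier_vec (p_f * p_s). block p_s i (\<psi> y) = \<psi>' (block p_s i y)))"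

text \<open>
  The layer computes \<open>z \<mapsto> A z + b\<close> on the coordinates \<open>(i, 0)\<close>. If \<open>A\<close> has fewer than \<open>p_f\<close>
  columns, the surplus coordinates are zero on entry; if it has fewer than \<open>p_f\<close> rows, the surplus
  output coordinates are arbitrary.
\<close>

definition encodes_affine ::
  "(real \<Rightarrow> real) set \<Rightarrow> nat \<Rightarrow> nat \<Rightarrow> coeff_tensor \<Rightarrow> real mat \<Rightarrow> real vec \<Rightarrow> bool" where
  "encodes_affine \<Phi> p_f p_s C A b \<longleftrightarrow>
     (\<forall>y\<in>carrier_vec (p_f * p_s).
        (\<forall>j<p_f. dim_col A \<le> j \<longrightarrow> y $ (j * p_s) = 0) \<longrightarrow>
        (\<forall>i<dim_row A. (y + ct_layer \<Phi> (p_f * p_s) C y) $ (i * p_s) =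
           (A *\<^sub>v vec (dim_col A) (\<lambda>j. y $ (j * p_s)) + b) $ i))"

definition encodes_parallel ::
  "(real \<Rightarrow> real) set \<Rightarrow> nat \<Rightarrow> nat \<Rightarrow> coeff_tensor \<Rightarrow> coeff_tensor \<Rightarrow> bool" where
  "encodes_parallel \<Phi> p_f p_s C C' \<longleftrightarrow>
     (\<forall>i<p_f. \<forall>y\<in>carrier_vec (p_f * p_s).
        block p_s i (ct_layer \<Phi> (p_f * p_s) C y) = ct_layer \<Phi> p_s C' (block p_s i y))"

text \<open>
  A compositional tensor for \<open>\<sigma>\<close> may leave non-zero values in its auxiliary coordinates, so running
  it again after overwriting the first coordinate only need not compute \<open>\<sigma>\<close> again. \<open>restart\<close> is the
  state after successive runs on the inputs of a list without clearing the auxiliary coordinates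
  in between, and \<open>restartable\<close> says that \<open>m\<close> successive runs all return \<open>\<sigma>\<close> of their input. For
  \<open>m \<le> 1\<close> and for width 1 this is no more than the statement that \<open>\<sigma>\<close> is represented; it also
  holds for every \<open>m\<close> if the auxiliary coordinates are zero at the end of each run.
\<close>

definition restart ::
  "(real \<Rightarrow> real) set \<Rightarrow> nat \<Rightarrow> coeff_tensor list \<Rightarrow> real list \<Rightarrow> real vec" where
  "restart \<Phi> p Cs xs =
     foldl (\<lambda>y x. ct_run \<Phi> p Cs (vec p (\<lambda>k. if k = 0 then x else y $ k))) (0\<^sub>v p) xs"

definition restartable ::
  "(real \<Rightarrow> real) set \<Rightarrow> nat \<Rightarrow> coeff_tensor list \<Rightarrow> (real \<Rightarrow> real) \<Rightarrow> nat \<Rightarrow> bool" where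
  "restartable \<Phi> p Cs \<sigma> m \<longleftrightarrow>
     (\<forall>xs. xs \<noteq> [] \<and> length xs \<le> m \<longrightarrow> restart \<Phi> p Cs xs $ 0 = \<sigma> (last xs))"

end

theory Submission
  imports Defs
begin

text \<open>
  An affine map \<open>z \<mapsto> A z + b\<close> is the residual layer \<open>Id + ((A - I) z + b)\<close>, whose coefficients sit on
  the multi-indices with at most one factor \<open>t\<close> and otherwise constant factors 1; a layer of \<open>\<sigma>\<close> is
  copied into each block by padding its multi-indices with the constant 1. A function
  \<open>c + (\<Sum>j. W\<^sub>j g(x\<^sub>j))\<close> of \<open>p\<^sub>f\<close> coordinates has TT cores that carry the running sum in one column
  and the not yet used \<open>W\<^sub>j\<close> in the others; as the first coordinate is used at once, \<open>p\<^sub>f\<close> columns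
  suffice. If the tensor of \<open>\<sigma>\<close> cannot be restarted, the affine layers in addition reset the
  auxiliary coordinates; neither the parameter count nor the TT bound is claimed then.
\<close>

section \<open>Sparse coefficient tensors\<close>

lemma finite_multi_indices: "finite \<Phi> \<Longrightarrow> finite (multi_indices \<Phi> p)"
  unfolding multi_indices_def by (intro finite_PiE) auto

text \<open>The value \<open>a j i\<close> is placed at the multi-index \<open>e j i\<close>.
  Summing over labels makes coinciding multi-indices add their values, so a layer is evaluated by
  exchanging two sums. The place may depend on the output \<open>j\<close>, which lets parallel
  blocks read different coordinates.\<close>

definition sparse_tensor ::
  "'i set \<Rightarrow> (nat \<Rightarrow> 'i \<Rightarrow> nat \<Rightarrow> real \<Rightarrow> real) \<Rightarrow> (nat \<Rightarrow> 'i \<Rightarrow> real) \<Rightarrow> coeff_tensor" where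
  "sparse_tensor I e a j \<mu> = (\<Sum>i\<in>I. if e j i = \<mu> then a j i else 0)"

lemma sparse_tensor_outside: "\<mu> \<notin> e j ` I \<Longrightarrow> sparse_tensor I e a j \<mu> = 0"
  unfolding sparse_tensor_def by (intro sum.neutral) auto

lemma sparse_tensor_inside:
  assumes "finite I" "inj_on (e j) I" "i \<in> I"
  shows "sparse_tensor I e a j (e j i) = a j i"
proof -
  have "sparse_tensor I e a j (e j i) = (\<Sum>i'\<in>I. if i' = i then a j i' else 0)"
    unfolding sparse_tensor_def using assms by (intro sum.cong) (auto simp: inj_on_def)
  then show ?thesis using assms by simp
qed

lemma ct_layer_sparse_tensor:
  assumes "finite \<Phi>" "finite I"
    and e: "\<And>j i. j < p \<Longrightarrow> i \<in> I \<Longrightarrow> e j i \<in> multi_indices \<Phi> p"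
  shows "ct_layer \<Phi> p (sparse_tensor I e a) x =
    vec p (\<lambda>j. \<Sum>i\<in>I. a j i * (\<Prod>k<p. e j i k (x $ k)))"
  unfolding ct_layer_def
proof (rule eq_vecI, simp_all)
  fix j assume j: "j < p"
  let ?P = "\<lambda>\<mu>. \<Prod>k<p. \<mu> k (x $ k)"
  have "(\<Sum>\<mu>\<in>multi_indices \<Phi> p. sparse_tensor I e a j \<mu> * ?P \<mu>)
      = (\<Sum>\<mu>\<in>multi_indices \<Phi> p. \<Sum>i\<in>I. if e j i = \<mu> then a j i * ?P \<mu> else 0)"
    by (auto simp: sparse_tensor_def sum_distrib_right intro!: sum.cong)
  also have "\<dots> = (\<Sum>i\<in>I. \<Sum>\<mu>\<in>multi_indices \<Phi> p. if e j i = \<mu> then a j i * ?P \<mu> else 0)"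
    by (rule sum.swap)
  also have "\<dots> = (\<Sum>i\<in>I. a j i * ?P (e j i))"
    using e[OF j] finite_multi_indices[OF assms(1)] by (intro sum.cong) auto
  finally show "(\<Sum>\<mu>\<in>multi_indices \<Phi> p. sparse_tensor I e a j \<mu> * ?P \<mu>)
      = (\<Sum>i\<in>I. a j i * ?P (e j i))" .
qed

text \<open>Injectivity of \<open>e j\<close> rules out merging and cancellation of values, so
  nonzero entries correspond one to one to labels with nonzero value.\<close>

lemma num_params_sparse_tensor:
  assumes "finite I"
    and e: "\<And>j i. j < p \<Longrightarrow> i \<in> I \<Longrightarrow> e j i \<in> multi_indices \<Phi> p"
    and inj: "\<And>j. j < p \<Longrightarrow> inj_on (e j) I"
  shows "num_params \<Phi> p (sparse_tensor I e a) = card {(j, i). j < p \<and> i \<in> I \<and> a j i \<noteq> 0}"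
proof -
  let ?h = "\<lambda>(j, i). (j, e j i)" and ?S = "{(j, i). j < p \<and> i \<in> I \<and> a j i \<noteq> 0}"
  have at: "sparse_tensor I e a j (e j i) = a j i" if "j < p" "i \<in> I" for j i
    using assms(1) inj[OF that(1)] that(2) by (rule sparse_tensor_inside)
  have "{(j, \<mu>). j < p \<and> \<mu> \<in> multi_indices \<Phi> p \<and> sparse_tensor I e a j \<mu> \<noteq> 0} = ?h ` ?S"
  proof (intro equalityI subsetI)
    fix q assume "q \<in> {(j, \<mu>). j < p \<and> \<mu> \<in> multi_indices \<Phi> p \<and> sparse_tensor I e a j \<mu> \<noteq> 0}"
    then obtain j \<mu> where q: "q = (j, \<mu>)" "j < p" "sparse_tensor I e a j \<mu> \<noteq> 0" by auto
    then obtain i where "i \<in> I" "\<mu> = e j i"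
      using sparse_tensor_outside[of \<mu> e j I a] by auto
    then show "q \<in> ?h ` ?S"
      using q at by force
  qed (use e at in auto)
  moreover have "inj_on ?h ?S"
    using inj by (auto simp: inj_on_def)
  ultimately show ?thesis
    unfolding num_params_def by (simp add: card_image)
qed

section \<open>Affine layers\<close>

text \<open>The position \<open>s = p\<close> gives the constant multi-index.\<close>

definition affine_index :: "nat \<Rightarrow> nat \<Rightarrow> nat \<Rightarrow> real \<Rightarrow> real" where
  "affine_index p s = (\<lambda>t\<in>{..<p}. if t = s then (\<lambda>u. u) else (\<lambda>_. 1))"

definition affine_tensor :: "nat \<Rightarrow> (nat \<Rightarrow> nat \<Rightarrow> real) \<Rightarrow> (nat \<Rightarrow> real) \<Rightarrow> coeff_tensor" where
  "affine_tensor p W c =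
     sparse_tensor {..p} (\<lambda>_. affine_index p) (\<lambda>j s. if s = p then c j else W j s)"

lemma affine_index_in:
  "{\<lambda>_. 1, \<lambda>t. t} \<subseteq> \<Phi> \<Longrightarrow> affine_index p s \<in> multi_indices \<Phi> p"
  by (auto simp: affine_index_def multi_indices_def)

lemma id_neq_one: "(\<lambda>u::real. u) \<noteq> (\<lambda>_. 1)"
  by (metis zero_neq_one)

text \<open>At a position \<open>s < p\<close> the multi-index of \<open>s\<close> has the identity
  while that of any other position has the constant 1. Of two distinct positions in
  \<open>{..p}\<close> at least one is below \<open>p\<close> and tells them apart.\<close>

lemma inj_affine_index: "inj_on (affine_index p) {..p}"
proof (rule inj_onI)
  have at: "affine_index p s t = (if t = s then (\<lambda>u. u) else (\<lambda>_. 1))" if "t < p" for s t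
    using that by (simp add: affine_index_def)
  fix s s' assume le: "s \<in> {..p}" "s' \<in> {..p}" and eq: "affine_index p s = affine_index p s'"
  show "s = s'"
  proof (rule ccontr)
    assume "s \<noteq> s'"
    then consider "s < p" | "s' < p" using le by fastforce
    then show False
      using at[of s s] at[of s s'] at[of s' s] at[of s' s'] eq \<open>s \<noteq> s'\<close> id_neq_one
      by cases auto
  qed
qed

lemma prod_affine_index:
  "(\<Prod>k<p. affine_index p s k (x $ k)) = (if s < p then x $ s else 1)"
proof -
  have "(\<Prod>k<p. affine_index p s k (x $ k)) = (\<Prod>k<p. if k = s then x $ k else 1)"
    by (intro prod.cong) (auto simp: affine_index_def)
  then show ?thesis by simp
qed

lemma ct_layer_affine_tensor:
  assumes "finite \<Phi>" "{\<lambda>_. 1, \<lambda>t. t} \<subseteq> \<Phi>"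
  shows "ct_layer \<Phi> p (affine_tensor p W c) x = vec p (\<lambda>j. c j + (\<Sum>s<p. W j s * x $ s))"
proof -
  have "{..p} = insert p {..<p}" by auto
  then show ?thesis
    unfolding affine_tensor_def
    by (subst ct_layer_sparse_tensor[OF assms(1)])
      (auto simp: affine_index_in[OF assms(2)] prod_affine_index)
qed

lemma num_params_affine_tensor:
  assumes "{\<lambda>_. 1, \<lambda>t. t} \<subseteq> \<Phi>"
  shows "num_params \<Phi> p (affine_tensor p W c) =
    card {(j, s). j < p \<and> s < p \<and> W j s \<noteq> 0} + card {j. j < p \<and> c j \<noteq> 0}"
proof -
  let ?S = "{(j, s). j < p \<and> s < p \<and> W j s \<noteq> 0}" and ?T = "{j. j < p \<and> c j \<noteq> 0}"
  have "num_params \<Phi> p (affine_tensor p W c)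
      = card {(j, s). j < p \<and> s \<in> {..p} \<and> (if s = p then c j else W j s) \<noteq> 0}"
    unfolding affine_tensor_def
    by (rule num_params_sparse_tensor) (auto simp: affine_index_in[OF assms] inj_affine_index)
  also have "{(j, s). j < p \<and> s \<in> {..p} \<and> (if s = p then c j else W j s) \<noteq> 0}
      = ?S \<union> (\<lambda>j. (j, p)) ` ?T"
    by (auto simp: image_iff)
  \<comment> \<open>The bias entries have second component \<open>p\<close>, which no weight entry
    has.\<close>
  also have "card \<dots> = card ?S + card ((\<lambda>j. (j, p)) ` ?T)"
    by (intro card_Un_disjoint finite_subset[of ?S "{..<p} \<times> {..<p}"]) auto
  also have "card ((\<lambda>j. (j, p)) ` ?T) = card ?T"
    by (intro card_image) (auto simp: inj_on_def)
  finally show ?thesis .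
qed

text \<open>The values of the network live on the coordinates \<open>j * q\<close>; this turns sums
  over all coordinates of the tensor into sums over neurons.\<close>

lemma sum_stride:
  fixes f :: "nat \<Rightarrow> real"
  assumes "0 < q"
  shows "(\<Sum>s<n * q. if s mod q = 0 then f (s div q) else 0) = (\<Sum>j<n. f j)"
proof -
  have *: "{s \<in> {..<n * q}. s mod q = 0} = (\<lambda>j. j * q) ` {..<n}"
    using assms by (auto simp: image_iff less_mult_imp_div_less intro!: bexI[of _ "_ div q"])
  have "(\<Sum>s<n * q. if s mod q = 0 then f (s div q) else 0)
      = (\<Sum>s\<in>{s \<in> {..<n * q}. s mod q = 0}. f (s div q))"
    by (rule sum.inter_filter[symmetric]) simp
  also have "\<dots> = (\<Sum>j<n. f j)"
    unfolding * using assms by (subst sum.reindex) (auto simp: inj_on_def)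
  finally show ?thesis .
qed

text \<open>With \<open>clear\<close>, the layer also resets the auxiliary coordinates \<open>(i, k)\<close>, \<open>k \<noteq> 0\<close>, to zero,
  at the price of additional parameters.\<close>

definition layer_weight :: "bool \<Rightarrow> nat \<Rightarrow> real mat \<Rightarrow> nat \<Rightarrow> nat \<Rightarrow> real" where
  "layer_weight clear q M t s =
     (if t mod q = 0 then
        (if s mod q = 0 \<and> t div q < dim_row M \<and> s div q < dim_col M
         then (M - eye (dim_row M) (dim_col M)) $$ (t div q, s div q) else 0)
      else if clear \<and> s = t then -1 else 0)"

definition layer_bias :: "nat \<Rightarrow> real vec \<Rightarrow> nat \<Rightarrow> real" where
  "layer_bias q v t = (if t mod q = 0 \<and> t div q < dim_vec v then v $ (t div q) else 0)"

definition affine_layer :: "bool \<Rightarrow> nat \<Rightarrow> nat \<Rightarrow> real mat \<Rightarrow> real vec \<Rightarrow> coeff_tensor" where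
  "affine_layer clear n q M v = affine_tensor (n * q) (layer_weight clear q M) (layer_bias q v)"

text \<open>Row \<open>t\<close> of the weights vanishes, or with \<open>clear\<close> has the
  single entry -1 on the diagonal, which cancels the identity of the residual step.\<close>

lemma affine_layer_aux:
  assumes "finite \<Phi>" "{\<lambda>_. 1, \<lambda>t. t} \<subseteq> \<Phi>" "y \<in> carrier_vec (n * q)" "t < n * q" "t mod q \<noteq> 0"
  shows "(y + ct_layer \<Phi> (n * q) (affine_layer clear n q M v) y) $ t = (if clear then 0 else y $ t)"
proof -
  have "(\<Sum>s<n * q. layer_weight clear q M t s * y $ s)
      = (\<Sum>s<n * q. if s = t then (if clear then - y $ t else 0) else 0)"
    using assms by (intro sum.cong) (auto simp: layer_weight_def)
  then show ?thesis
    using assms by (simp add: affine_layer_def ct_layer_affine_tensor layer_bias_def)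
qed

text \<open>The skip connection restores the identity that \<open>layer_weight\<close>
  subtracts.\<close>

lemma encodes_affine_layer:
  assumes "finite \<Phi>" "{\<lambda>_. 1, \<lambda>t. t} \<subseteq> \<Phi>" "0 < q"
    and M: "dim_row M \<le> n" "dim_col M \<le> n" "dim_vec v = dim_row M"
  shows "encodes_affine \<Phi> n q (affine_layer clear n q M v) M v"
  unfolding encodes_affine_def
proof (intro ballI allI impI)
  fix y :: "real vec" and i
  assume y: "y \<in> carrier_vec (n * q)" and z: "\<forall>j<n. dim_col M \<le> j \<longrightarrow> y $ (j * q) = 0"
    and i: "i < dim_row M"
  let ?u = "vec (dim_col M) (\<lambda>j. y $ (j * q))"
  have iq: "i * q < n * q" using i M assms(3) by auto
  have "(\<Sum>s<n * q. layer_weight clear q M (i * q) s * y $ s)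
      = (\<Sum>s<n * q. if s mod q = 0 then
          (if s div q < dim_col M then (M - eye (dim_row M) (dim_col M)) $$ (i, s div q)
             * y $ (s div q * q) else 0) else 0)"
    using i assms(3) by (intro sum.cong) (auto simp: layer_weight_def)
  also have "\<dots> = (\<Sum>j<n. if j < dim_col M then
      (M - eye (dim_row M) (dim_col M)) $$ (i, j) * y $ (j * q) else 0)"
    by (rule sum_stride[OF assms(3)])
  also have "\<dots> = (\<Sum>j<dim_col M. (M - eye (dim_row M) (dim_col M)) $$ (i, j) * y $ (j * q))"
    using M by (intro sum.mono_neutral_cong_right) auto
  also have "\<dots> = (\<Sum>j<dim_col M. M $$ (i, j) * y $ (j * q) - (if i = j then y $ (j * q) else 0))"
    using i by (intro sum.cong) (auto simp: eye_def algebra_simps)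
  \<comment> \<open>If \<open>i\<close> is at least \<open>dim_col M\<close>, row \<open>i\<close>
    of \<open>eye\<close> is zero and nothing compensates the skip connection; then
    \<open>y $ (i * q)\<close> is itself zero by \<open>z\<close>.\<close>
  also have "\<dots> = (\<Sum>j<dim_col M. M $$ (i, j) * y $ (j * q)) - y $ (i * q)"
    using z i M by (auto simp: sum_subtractf)
  also have "(\<Sum>j<dim_col M. M $$ (i, j) * y $ (j * q)) = (M *\<^sub>v ?u) $ i"
    using i by (simp add: scalar_prod_def lessThan_atLeast0)
  finally show "(y + ct_layer \<Phi> (n * q) (affine_layer clear n q M v) y) $ (i * q) = (M *\<^sub>v ?u + v) $ i"
    using assms(3) M i iq y
    by (simp add: affine_layer_def ct_layer_affine_tensor[OF assms(1,2)] layer_bias_def)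
qed

text \<open>Without resets, nonzero weights have row and column divisible by \<open>q\<close> and
  nonzero biases have a row divisible by \<open>q\<close>; division by \<open>q\<close> recovers the
  entry of \<open>A - I\<close> or \<open>b\<close> that they come from.\<close>

lemma num_params_affine_layer:
  assumes "{\<lambda>_. 1, \<lambda>t. t} \<subseteq> \<Phi>" "0 < q"
    and M: "dim_row M \<le> n" "dim_col M \<le> n" "dim_vec v = dim_row M"
  shows "num_params \<Phi> (n * q) (affine_layer False n q M v) = affine_params M v"
proof -
  let ?N = "M - eye (dim_row M) (dim_col M)"
  have dimN: "dim_row ?N = dim_row M" "dim_col ?N = dim_col M" by (simp_all add: eye_def)
  have lt: "i * q < n * q" if "i < k" "k \<le> n" for i k using that assms(2) by auto
  have "{(j, s). j < n * q \<and> s < n * q \<and> layer_weight False q M j s \<noteq> 0}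
      = (\<lambda>(i, j). (i * q, j * q)) ` {(i, j). i < dim_row ?N \<and> j < dim_col ?N \<and> ?N $$ (i, j) \<noteq> 0}"
    (is "?S = ?h ` ?T")
  proof (intro equalityI subsetI)
    fix w assume "w \<in> ?S"
    then obtain j s where w: "w = (j, s)" and nz: "layer_weight False q M j s \<noteq> 0" by blast
    have dvd: "j mod q = 0" "s mod q = 0"
      using nz unfolding layer_weight_def by presburger+
    have "j div q < dim_row M \<and> s div q < dim_col M \<and> ?N $$ (j div q, s div q) \<noteq> 0"
      using nz unfolding layer_weight_def by presburger
    then have "(j div q, s div q) \<in> ?T"
      by (simp only: mem_Collect_eq case_prod_conv dimN simp_thms)
    moreover have "w = ?h (j div q, s div q)"
      using dvd w by (simp add: mod_0_imp_dvd)
    ultimately show "w \<in> ?h ` ?T" by (rule rev_image_eqI)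
  next
    fix w assume "w \<in> ?h ` ?T"
    then obtain z where "w = ?h z" "z \<in> ?T" by (rule imageE)
    moreover obtain i j where "z = (i, j)" by fastforce
    ultimately have "w = (i * q, j * q)" "i < dim_row M" "j < dim_col M" "?N $$ (i, j) \<noteq> 0"
      by (simp_all only: mem_Collect_eq case_prod_conv dimN simp_thms)
    then show "w \<in> ?S"
      using assms(2) M lt[of i "dim_row M"] lt[of j "dim_col M"] by (simp add: layer_weight_def eye_def)
  qed
  moreover have "inj_on (\<lambda>(i, j). (i * q, j * q)) S" for S
    using assms(2) by (auto simp: inj_on_def)
  moreover have "{j. j < n * q \<and> layer_bias q v j \<noteq> 0} = (\<lambda>i. i * q) ` {i. i < dim_vec v \<and> v $ i \<noteq> 0}"
    (is "?S' = ?h' ` ?T'")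
  proof (intro equalityI subsetI)
    fix t assume "t \<in> ?S'"
    then have "t div q \<in> ?T'" "t = ?h' (t div q)"
      by (auto simp: layer_bias_def split: if_splits)
    then show "t \<in> ?h' ` ?T'" by blast
  next
    fix t assume "t \<in> ?h' ` ?T'"
    then obtain i where "t = i * q" "i < dim_vec v" "v $ i \<noteq> 0" by auto
    then show "t \<in> ?S'"
      using assms(2) M lt[of i "dim_vec v"] by (simp add: layer_bias_def)
  qed
  moreover have "inj_on (\<lambda>i. i * q) S" for S
    using assms(2) by (auto simp: inj_on_def)
  ultimately show ?thesis
    unfolding affine_layer_def num_params_affine_tensor[OF assms(1)] affine_params_def
      nnz_mat_def nnz_vec_def by (simp add: card_image)
qed

section \<open>Parallel layers\<close>

definition block_index ::
  "nat \<Rightarrow> nat \<Rightarrow> nat \<Rightarrow> (nat \<Rightarrow> real \<Rightarrow> real) \<Rightarrow> nat \<Rightarrow> real \<Rightarrow> real" where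
  "block_index n q i \<mu> = (\<lambda>t\<in>{..<n * q}. if t div q = i then \<mu> (t mod q) else (\<lambda>_. 1))"

definition parallel_layer ::
  "(real \<Rightarrow> real) set \<Rightarrow> nat \<Rightarrow> nat \<Rightarrow> coeff_tensor \<Rightarrow> coeff_tensor" where
  "parallel_layer \<Phi> n q C =
     sparse_tensor (multi_indices \<Phi> q) (\<lambda>j. block_index n q (j div q)) (\<lambda>j. C (j mod q))"

lemma block_coord_less: "i < n \<Longrightarrow> k < q \<Longrightarrow> i * q + k < n * (q::nat)"
  using mult_le_mono1[of "Suc i" n q] by simp

lemma block_index_in:
  assumes "{\<lambda>_. 1, \<lambda>t. t} \<subseteq> \<Phi>" "0 < q" "\<mu> \<in> multi_indices \<Phi> q"
  shows "block_index n q i \<mu> \<in> multi_indices \<Phi> (n * q)"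
  using assms by (auto simp: block_index_def multi_indices_def PiE_iff)

lemma block_index_at:
  "i < n \<Longrightarrow> k < q \<Longrightarrow> block_index n q i \<mu> (i * q + k) = \<mu> k"
  using block_coord_less by (simp add: block_index_def)

text \<open>The factors at the coordinates of block \<open>i\<close> give back the original
  multi-index; \<open>i < n\<close> ensures that these coordinates exist.\<close>

lemma inj_block_index: "i < n \<Longrightarrow> inj_on (block_index n q i) (multi_indices \<Phi> q)"
proof (rule inj_onI)
  fix \<mu> \<nu> assume i: "i < n" and eq: "block_index n q i \<mu> = block_index n q i \<nu>"
    and "\<mu> \<in> multi_indices \<Phi> q" "\<nu> \<in> multi_indices \<Phi> q"
  moreover have "\<mu> k = \<nu> k" if "k < q" for k
    using block_index_at[OF i that, of \<mu>] block_index_at[OF i that, of \<nu>] eq by simp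
  ultimately show "\<mu> = \<nu>"
    unfolding multi_indices_def by (intro PiE_ext[of \<mu> "{..<q}" "\<lambda>_. \<Phi>"]) auto
qed

lemma prod_block_index:
  assumes "i < n"
  shows "(\<Prod>t<n * q. block_index n q i \<mu> t (y $ t)) = (\<Prod>k<q. \<mu> k (y $ (i * q + k)))"
proof -
  have "(\<Prod>t<n * q. block_index n q i \<mu> t (y $ t))
      = (\<Prod>t\<in>(\<lambda>k. i * q + k) ` {..<q}. block_index n q i \<mu> t (y $ t))"
  proof (intro prod.mono_neutral_right ballI)
    show "(\<lambda>k. i * q + k) ` {..<q} \<subseteq> {..<n * q}"
      using assms block_coord_less by auto
    fix t assume t: "t \<in> {..<n * q} - (\<lambda>k. i * q + k) ` {..<q}"
    then have "0 < q" by (cases q) auto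
    \<comment> \<open>By division with remainder, a \<open>t\<close> with quotient \<open>i\<close>
      would be the image of \<open>t mod q\<close>.\<close>
    then have "t div q \<noteq> i"
      using t by (auto simp: image_iff) (metis div_mult_mod_eq lessThan_iff mod_less_divisor)
    then show "block_index n q i \<mu> t (y $ t) = 1"
      using t by (simp add: block_index_def)
  qed simp
  then show ?thesis
    using assms by (simp add: prod.reindex block_index_at)
qed

lemma encodes_parallel_layer:
  assumes "finite \<Phi>" "{\<lambda>_. 1, \<lambda>t. t} \<subseteq> \<Phi>" "0 < q"
  shows "encodes_parallel \<Phi> n q (parallel_layer \<Phi> n q C) C"
  unfolding encodes_parallel_def
proof (intro allI impI ballI)
  fix i y assume i: "i < n"
  have "ct_layer \<Phi> (n * q) (parallel_layer \<Phi> n q C) y = vec (n * q) (\<lambda>j.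
      \<Sum>\<mu>\<in>multi_indices \<Phi> q. C (j mod q) \<mu> * (\<Prod>k<n * q. block_index n q (j div q) \<mu> k (y $ k)))"
    unfolding parallel_layer_def
    by (rule ct_layer_sparse_tensor)
      (use assms block_index_in finite_multi_indices in auto)
  then show "block q i (ct_layer \<Phi> (n * q) (parallel_layer \<Phi> n q C) y) = ct_layer \<Phi> q C (block q i y)"
    unfolding block_def ct_layer_def
    using i block_coord_less[OF i] by (auto simp: prod_block_index intro!: eq_vecI)
qed

text \<open>Division with remainder by \<open>q\<close> splits an output coordinate into a block and
  a place in it, and every block holds the same coefficients.\<close>

lemma num_params_parallel_layer:
  assumes "finite \<Phi>" "{\<lambda>_. 1, \<lambda>t. t} \<subseteq> \<Phi>" "0 < q"
  shows "num_params \<Phi> (n * q) (parallel_layer \<Phi> n q C) = n * num_params \<Phi> q C"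
proof -
  let ?S = "{(k, \<mu>). k < q \<and> \<mu> \<in> multi_indices \<Phi> q \<and> C k \<mu> \<noteq> 0}"
  let ?h = "\<lambda>(i, k, \<mu>). (i * q + k, \<mu>)"
  have "num_params \<Phi> (n * q) (parallel_layer \<Phi> n q C)
      = card {(j, \<mu>). j < n * q \<and> \<mu> \<in> multi_indices \<Phi> q \<and> C (j mod q) \<mu> \<noteq> 0}"
    unfolding parallel_layer_def
    by (rule num_params_sparse_tensor)
      (use assms block_index_in finite_multi_indices in
        \<open>auto intro!: inj_block_index simp: less_mult_imp_div_less\<close>)
  also have "{(j, \<mu>). j < n * q \<and> \<mu> \<in> multi_indices \<Phi> q \<and> C (j mod q) \<mu> \<noteq> 0}
      = ?h ` ({..<n} \<times> ?S)"
  proof (intro equalityI subsetI)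
    fix w assume "w \<in> {(j, \<mu>). j < n * q \<and> \<mu> \<in> multi_indices \<Phi> q \<and> C (j mod q) \<mu> \<noteq> 0}"
    then show "w \<in> ?h ` ({..<n} \<times> ?S)"
      using assms(3)
      by (auto simp: less_mult_imp_div_less
          intro!: image_eqI[of _ _ "(fst w div q, fst w mod q, snd w)"])
  qed (auto simp: block_coord_less)
  also have "card \<dots> = card ({..<n} \<times> ?S)"
  proof (rule card_image, rule inj_onI, clarsimp)
    fix i k i' k' assume "i * q + k = i' * q + k'" "k < q" "k' < q"
    then show "i = i' \<and> k = k'"
      by (metis add.commute add_right_cancel div_mult_self3 div_less mod_mult_self3 mod_less
          add_0_right less_nat_zero_code)
  qed
  finally show ?thesis
    by (simp add: num_params_def card_cartesian_product)
qed

text \<open>The layer of \<open>C\<close> itself is the witness for every block, so its cores are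
  reused unchanged.\<close>

lemma block_tt_bounded_parallel_layer:
  assumes "finite \<Phi>" "{\<lambda>_. 1, \<lambda>t. t} \<subseteq> \<Phi>" "0 < q" "tt_bounded \<Phi> q r (ct_layer \<Phi> q C)"
  shows "block_tt_bounded \<Phi> n q r (ct_layer \<Phi> (n * q) (parallel_layer \<Phi> n q C))"
  using encodes_parallel_layer[OF assms(1-3), of n C] assms(4)
  unfolding block_tt_bounded_def encodes_parallel_def by blast

section \<open>Running parallel layers block by block\<close>

lemma block_add:
  "i < n \<Longrightarrow> y \<in> carrier_vec (n * q) \<Longrightarrow> z \<in> carrier_vec (n * q) \<Longrightarrow>
    block q i (y + z) = block q i y + block q i z"
  using block_coord_less by (auto simp: block_def intro!: eq_vecI)

lemma ct_layer_carrier: "ct_layer \<Phi> p C x \<in> carrier_vec p"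
  by (simp add: ct_layer_def)

lemma ct_run_append: "ct_run \<Phi> p (Cs @ Ds) x = ct_run \<Phi> p Ds (ct_run \<Phi> p Cs x)"
  by (simp add: ct_run_def)

lemma ct_run_Cons: "ct_run \<Phi> p (C # Cs) x = ct_run \<Phi> p Cs (x + ct_layer \<Phi> p C x)"
  by (simp add: ct_run_def)

lemma ct_run_carrier: "x \<in> carrier_vec p \<Longrightarrow> ct_run \<Phi> p Cs x \<in> carrier_vec p"
  by (induction Cs arbitrary: x) (simp_all add: ct_run_Cons ct_layer_carrier, simp add: ct_run_def)

text \<open>No block reads another one, so restriction to a block commutes with every residual
  step.\<close>

lemma block_ct_run_parallel:
  assumes "finite \<Phi>" "{\<lambda>_. 1, \<lambda>t. t} \<subseteq> \<Phi>" "0 < q" "i < n" "y \<in> carrier_vec (n * q)"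
  shows "block q i (ct_run \<Phi> (n * q) (map (parallel_layer \<Phi> n q) Cs) y) = ct_run \<Phi> q Cs (block q i y)"
  using assms(5)
proof (induction Cs arbitrary: y)
  case (Cons C Cs)
  have "block q i (ct_layer \<Phi> (n * q) (parallel_layer \<Phi> n q C) y) = ct_layer \<Phi> q C (block q i y)"
    using encodes_parallel_layer[OF assms(1-3)] assms(4) Cons.prems
    unfolding encodes_parallel_def by blast
  then show ?case
    using Cons assms(4) by (simp add: ct_run_Cons block_add ct_layer_carrier)
qed (simp add: ct_run_def)

section \<open>TT ranks\<close>

lemma sum_single_coeff:
  fixes \<phi> :: "real \<Rightarrow> real"
  assumes "finite \<Phi>" "\<phi> \<in> \<Phi>"
  shows "(\<Sum>\<psi>\<in>\<Phi>. (if \<psi> = \<phi> then \<alpha> else 0) * \<psi> t) = \<alpha> * \<phi> t"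
proof -
  have "(\<Sum>\<psi>\<in>\<Phi>. (if \<psi> = \<phi> then \<alpha> else 0) * \<psi> t) = (\<Sum>\<psi>\<in>\<Phi>. if \<psi> = \<phi> then \<alpha> * \<psi> t else 0)"
    by (intro sum.cong) auto
  then show ?thesis using assms by simp
qed

lemma fun_span_basis:
  assumes "finite \<Phi>" "\<phi> \<in> \<Phi>"
  shows "\<phi> \<in> fun_span \<Phi>"
  unfolding fun_span_def using sum_single_coeff[OF assms, of 1]
  by (intro CollectI exI[of _ "\<lambda>\<psi>. if \<psi> = \<phi> then 1 else 0"]) simp

text \<open>All core entries used below have this form. The constant basis function absorbs
  \<open>\<alpha>\<close>, on top of the coefficient it may already have in
  \<open>g\<close>.\<close>

lemma fun_span_affine:
  assumes "finite \<Phi>" "(\<lambda>_. 1) \<in> \<Phi>" "g \<in> fun_span \<Phi>"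
  shows "(\<lambda>t. \<alpha> + \<beta> * g t) \<in> fun_span \<Phi>"
proof -
  obtain c where c: "\<And>t. g t = (\<Sum>\<phi>\<in>\<Phi>. c \<phi> * \<phi> t)"
    using assms(3) by (auto simp: fun_span_def)
  have "\<alpha> + \<beta> * g t
      = (\<Sum>\<phi>\<in>\<Phi>. ((if \<phi> = (\<lambda>_. 1) then \<alpha> else 0) + \<beta> * c \<phi>) * \<phi> t)" for t
    using sum_single_coeff[OF assms(1,2), of \<alpha>]
    by (simp add: c distrib_right sum.distrib sum_distrib_left mult.assoc)
  then show ?thesis
    unfolding fun_span_def
    by (intro CollectI exI[of _ "\<lambda>\<phi>. (if \<phi> = (\<lambda>_. 1) then \<alpha> else 0) + \<beta> * c \<phi>"] allI)
qed

text \<open>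
  The first core holds the columns of \<open>W\<close>, with the bias and the contribution of the first coordinate
  accumulated in column 0; the core at coordinate \<open>j * q\<close> adds \<open>g\<close> of that coordinate times
  column \<open>j\<close> to column 0, and all other cores are identities.
\<close>

lemma tt_bounded_additive:
  fixes W :: "nat \<Rightarrow> nat \<Rightarrow> real"
  assumes \<Phi>: "finite \<Phi>" "(\<lambda>_. 1) \<in> \<Phi>" and g: "g \<in> fun_span \<Phi>" and pos: "0 < n" "0 < q"
  shows "tt_bounded \<Phi> (n * q) (n * q # replicate (n * q - 1) n)
    (\<lambda>x. vec (n * q) (\<lambda>a. c a + (\<Sum>j<n. W a j * g (x $ (j * q)))))"
proof -
  let ?p = "n * q"
  let ?r = "?p # replicate (?p - 1) n"
  define r where "r = (\<lambda>s. (?r @ [1]) ! s)"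
  have r0: "r 0 = ?p" and rmid: "\<And>s. 0 < s \<Longrightarrow> s < ?p \<Longrightarrow> r s = n" and rp: "r ?p = 1"
    by (auto simp: r_def nth_append nth_Cons' pos)
  have p: "0 < ?p" using pos by simp
  \<comment> \<open>Core entries are \<open>\<alpha> + \<beta> * g t\<close>. Core 0 starts the
    running sum in column 0 with the bias and the term of coordinate 0; its other columns copy
    \<open>W\<close>.\<close>
  define \<alpha> where "\<alpha> s a k = (if s = (0::nat) then if k = 0 then c a else W a k
    else if a = k then 1 else 0)" for s a k
  define \<beta> where "\<beta> s a k = (if k = (0::nat) then if s = (0::nat) then W a 0
    else if a * q = s then 1 else 0 else 0)" for s a k
  define U where "U s t = mat (r s) (r (Suc s)) (\<lambda>(a, k). \<alpha> s a k + \<beta> s a k * g t)" for s t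
  have U: "U s t \<in> carrier_mat (r s) (r (Suc s))" for s t
    by (simp add: U_def)
  define tail where "tail x s = foldr (\<lambda>i M. U i (x $ i) * M) [s..<?p] (1\<^sub>m 1)" for x s
  have tail_step: "tail x s = U s (x $ s) * tail x (Suc s)" if "s < ?p" for x s
    using that by (simp add: tail_def upt_conv_Cons)
  have tail_carrier: "tail x s \<in> carrier_mat (r s) 1" if "s \<le> ?p" for x s
    using that
  proof (induction s rule: inc_induct)
    case base
    then show ?case by (simp add: tail_def rp)
  next
    case (step s)
    then show ?case using U mult_carrier_mat by (metis tail_step)
  qed
  have entry: "(U s t * M) $$ (a, 0) = (\<Sum>k<r (Suc s). (\<alpha> s a k + \<beta> s a k * g t) * M $$ (k, 0))"
    if "M \<in> carrier_mat (r (Suc s)) 1" "a < r s" for M s t a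
    using that by (auto simp: U_def scalar_prod_def lessThan_atLeast0 intro!: sum.cong)
  \<comment> \<open>Entry \<open>a\<close> is the factor by which the cores from \<open>s\<close> on
    multiply column \<open>a\<close>: 1 for the running sum, \<open>g\<close> of coordinate
    \<open>a * q\<close> if this coordinate is still to come, and 0 once it has been used.\<close>
  have tail_entry: "tail x s $$ (a, 0) =
      (if a = 0 then 1 else if s \<le> a * q then g (x $ (a * q)) else 0)"
    if "s \<le> ?p" "0 < s" "a < r s" for x s a
    using that
  proof (induction s arbitrary: a rule: inc_induct)
    case base
    then show ?case by (simp add: tail_def rp)
  next
    case (step s)
    let ?E = "\<lambda>s a. if a = 0 then 1 else if s \<le> a * q then g (x $ (a * q)) else 0"
    have a: "a < n" using step rmid by simp
    have "Suc s < ?p \<or> Suc s = ?p" using step.hyps by auto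
    then have "r (Suc s) = (if Suc s = ?p then 1 else n)"
      using rmid[of "Suc s"] rp by auto
    then have R: "0 < r (Suc s)" "r (Suc s) = (if Suc s = ?p then 1 else n)"
      using pos by auto
    have "a * q < ?p" using a pos by simp
    \<comment> \<open>The last core keeps column 0 only; a pending row must then have exactly this
      coordinate, so no term is lost when the rank drops to 1.\<close>
    then have last: "a * q = s" if "Suc s = ?p" "s \<le> a * q" using that by linarith
    have "tail x s $$ (a, 0)
        = (\<Sum>k<r (Suc s). (\<alpha> s a k + \<beta> s a k * g (x $ s)) * tail x (Suc s) $$ (k, 0))"
      using step tail_step[of s x] entry[OF tail_carrier[of "Suc s" x]] by simp
    also have "\<dots> = (\<Sum>k<r (Suc s). (\<alpha> s a k + \<beta> s a k * g (x $ s)) * ?E (Suc s) k)"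
      using step by (intro sum.cong) auto
    \<comment> \<open>Row \<open>a\<close> of a later core is a unit row, plus \<open>g\<close> in
      column 0 when \<open>s\<close> is the coordinate of \<open>a\<close>; there it meets the
      factor 1 of the running sum.\<close>
    also have "\<dots> = (\<Sum>k<r (Suc s). (if k = a then ?E (Suc s) a else 0)
        + (if k = 0 then if a * q = s then g (x $ s) else 0 else 0))"
      using step by (intro sum.cong) (auto simp: \<alpha>_def \<beta>_def)
    also have "\<dots> = (if a < r (Suc s) then ?E (Suc s) a else 0) + (if a * q = s then g (x $ s) else 0)"
      using R by (simp add: sum.distrib)
    also have "\<dots> = ?E s a"
      using R a last step by (auto simp: le_less_Suc_eq not_less_eq_eq)
    finally show ?case .
  qed
  have "vec ?p (\<lambda>a. c a + (\<Sum>j<n. W a j * g (x $ (j * q)))) = col (tail x 0) 0" for x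
  proof (rule eq_vecI)
    show "dim_vec (vec ?p (\<lambda>a. c a + (\<Sum>j<n. W a j * g (x $ (j * q))))) = dim_vec (col (tail x 0) 0)"
      using tail_carrier[of 0 x] r0 by simp
    fix a assume "a < dim_vec (col (tail x 0) 0)"
    then have a: "a < ?p" using tail_carrier[of 0 x] r0 by simp
    \<comment> \<open>If \<open>?p\<close> is 1, this is the final rank 1, which agrees with
      \<open>n = 1\<close>.\<close>
    have R: "r (Suc 0) = n"
    proof (cases "?p = 1")
      case True
      then show ?thesis using rp by simp
    next
      case False
      then show ?thesis using rmid[of "Suc 0"] p by linarith
    qed
    have "tail x 0 $$ (a, 0)
        = (\<Sum>k<n. (\<alpha> 0 a k + \<beta> 0 a k * g (x $ 0)) * tail x (Suc 0) $$ (k, 0))"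
      using tail_step[OF p, of x] entry[OF tail_carrier[of "Suc 0" x], where a = a] p a r0 R
      by (simp add: Suc_le_eq)
    \<comment> \<open>After the first core every coordinate \<open>k * q\<close> with
      \<open>k > 0\<close> is still pending.\<close>
    also have "\<dots> = (\<Sum>k<n. (\<alpha> 0 a k + \<beta> 0 a k * g (x $ 0)) * (if k = 0 then 1 else g (x $ (k * q))))"
      using tail_entry[of "Suc 0" _ x] p pos R by (intro sum.cong) (auto simp: Suc_le_eq)
    also have "\<dots> = (\<Sum>k<n. (if k = 0 then c a else 0) + W a k * g (x $ (k * q)))"
      by (intro sum.cong) (auto simp: \<alpha>_def \<beta>_def)
    also have "\<dots> = c a + (\<Sum>j<n. W a j * g (x $ (j * q)))"
      using pos by (simp add: sum.distrib)
    finally show "vec ?p (\<lambda>a. c a + (\<Sum>j<n. W a j * g (x $ (j * q)))) $ a = col (tail x 0) 0 $ a"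
      using a tail_carrier[of 0 x] r0 by simp
  qed
  moreover have "(\<lambda>t. U i t $$ (a, k)) \<in> fun_span \<Phi>" if "a < r i" "k < r (Suc i)" for i a k
    using that fun_span_affine[OF \<Phi> g] by (simp add: U_def)
  ultimately show ?thesis
    unfolding tt_bounded_def tail_def
    using U p r0 unfolding r_def by (intro conjI exI[of _ U]) auto
qed

text \<open>Without resets no weight sits on an auxiliary input coordinate, so the layer is additive
  in the \<open>n\<close> coordinates \<open>j * q\<close> with \<open>g\<close> the
  identity.\<close>

lemma tt_bounded_affine_layer:
  assumes "finite \<Phi>" "{\<lambda>_. 1, \<lambda>t. t} \<subseteq> \<Phi>" "0 < n" "0 < q"
  shows "tt_bounded \<Phi> (n * q) (n * q # replicate (n * q - 1) n)
    (ct_layer \<Phi> (n * q) (affine_layer False n q M v))"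
proof -
  have "ct_layer \<Phi> (n * q) (affine_layer False n q M v) = (\<lambda>x. vec (n * q) (\<lambda>a.
      layer_bias q v a + (\<Sum>j<n. layer_weight False q M a (j * q) * x $ (j * q))))"
    unfolding affine_layer_def ct_layer_affine_tensor[OF assms(1,2)]
  proof (intro ext arg_cong[where f = "vec _"] arg_cong2[where f = "(+)"] refl)
    fix x :: "real vec" and a
    have "(\<Sum>s<n * q. layer_weight False q M a s * x $ s) = (\<Sum>s<n * q. if s mod q = 0 then
        layer_weight False q M a (s div q * q) * x $ (s div q * q) else 0)"
      by (intro sum.cong) (auto simp: layer_weight_def)
    then show "(\<Sum>s<n * q. layer_weight False q M a s * x $ s)
        = (\<Sum>j<n. layer_weight False q M a (j * q) * x $ (j * q))"
      using sum_stride[OF assms(4), where n = n and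
            f = "\<lambda>j. layer_weight False q M a (j * q) * x $ (j * q)"] by simp
  qed
  moreover have "(\<lambda>t. t) \<in> fun_span \<Phi>"
    using assms by (intro fun_span_basis) auto
  ultimately show ?thesis
    using tt_bounded_additive[where g = "\<lambda>t. t" and \<Phi> = \<Phi> and n = n and q = q] assms by simp
qed

section \<open>The encoding network\<close>

text \<open>The prefix of the encoding up to the \<open>l\<close>-th application of the activation.
  Extending it at the end makes induction on \<open>l\<close> follow the evaluation.\<close>

primrec interleave :: "(nat \<Rightarrow> 'a) \<Rightarrow> 'a list \<Rightarrow> nat \<Rightarrow> 'a list" where
  "interleave f S 0 = []"
| "interleave f S (Suc l) = interleave f S l @ f (Suc l) # S"

lemma length_interleave [simp]: "length (interleave f S n) = n * (length S + 1)"
  by (induction n) auto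

lemma nth_interleave_head: "l < n \<Longrightarrow> interleave f S n ! (l * (length S + 1)) = f (Suc l)"
proof (induction n)
  case (Suc n)
  have "l * (length S + 1) < n * (length S + 1)" if "l < n"
    using that by (intro mult_less_mono1) auto
  then show ?case
    using Suc by (cases "l = n") (auto simp: nth_append)
qed simp

lemma nth_interleave_tail:
  "l < n \<Longrightarrow> s < length S \<Longrightarrow> interleave f S n ! (l * (length S + 1) + 1 + s) = S ! s"
proof (induction n)
  case (Suc n)
  have "l * (length S + 1) + 1 + s < n * (length S + 1)" if "l < n"
    using block_coord_less[of l n "1 + s" "length S + 1"] that Suc.prems by simp
  then show ?case
    using Suc by (cases "l = n") (auto simp: nth_append)
qed simp

section \<open>Restarted runs, lift and retraction\<close>

lemma restart_snoc:
  "restart \<Phi> p Cs (xs @ [z]) =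
    ct_run \<Phi> p Cs (vec p (\<lambda>k. if k = 0 then z else restart \<Phi> p Cs xs $ k))"
  unfolding restart_def by simp

text \<open>A first run starts from zero auxiliary coordinates, which is exactly the lift of
  \<sigma>.\<close>

lemma restartable_one:
  assumes "compositional_tensor \<Phi> p Cs (act_lift p) act_retr 1 1 (map_vec \<sigma>)"
  shows "restartable \<Phi> p Cs \<sigma> 1"
  unfolding restartable_def
proof (intro allI impI)
  fix xs :: "real list"
  assume "xs \<noteq> [] \<and> length xs \<le> 1"
  then obtain z where xs: "xs = [] @ [z]" by (cases xs) auto
  let ?u = "vec 1 (\<lambda>_. z)"
  have "map_vec \<sigma> ?u = act_retr (ct_run \<Phi> p Cs (act_lift p ?u))"
    using assms by (simp add: compositional_tensor_def)
  then have "map_vec \<sigma> ?u $ 0 = act_retr (ct_run \<Phi> p Cs (act_lift p ?u)) $ 0"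
    by (rule arg_cong)
  moreover have "act_lift p ?u = vec p (\<lambda>k. if k = 0 then z else restart \<Phi> p Cs [] $ k)"
    by (auto simp: act_lift_def restart_def)
  ultimately show "restart \<Phi> p Cs xs $ 0 = \<sigma> (last xs)"
    unfolding xs restart_snoc by (simp add: act_retr_def)
qed

lemma linear_pair_lift: "linear_vec_map d (n * q) (pair_lift n q d)"
  by (auto simp: linear_vec_map_def pair_lift_def intro!: eq_vecI)

lemma linear_pair_retr:
  assumes "d\<^sub>o \<le> n" "0 < q"
  shows "linear_vec_map (n * q) d\<^sub>o (pair_retr q d\<^sub>o)"
proof -
  have "i * q < n * q" if "i < d\<^sub>o" for i using that assms by simp
  then show ?thesis
    by (auto simp: linear_vec_map_def pair_retr_def intro!: eq_vecI)
qed

text \<open>Serves both for the given tensor of \<sigma> and for a single layer of width 1. The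
  layers \<open>S\<close> are tied to \<open>\<sigma>\<close> through \<open>restartable\<close>,
  which is assumed where evaluation is concerned.\<close>

locale network_encoding =
  fixes \<Phi> :: "(real \<Rightarrow> real) set" and \<sigma> :: "real \<Rightarrow> real" and n q L d d\<^sub>o :: nat
    and S :: "coeff_tensor list" and A :: "nat \<Rightarrow> real mat" and b :: "nat \<Rightarrow> real vec"
  assumes basis: "finite \<Phi>" "{\<lambda>_. 1, \<lambda>t. t} \<subseteq> \<Phi>"
    and pos: "0 < n" "0 < q" "1 \<le> L"
    and width: "d \<le> n" "d\<^sub>o \<le> n"
    and A: "\<And>l. l \<in> {1..L} \<Longrightarrow> A l \<in> carrier_mat (nn_dim d n d\<^sub>o L l) (nn_dim d n d\<^sub>o L (l - 1))"
    and b: "\<And>l. l \<in> {1..L} \<Longrightarrow> b l \<in> carrier_vec (nn_dim d n d\<^sub>o L l)"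
begin

abbreviation aff :: "bool \<Rightarrow> nat \<Rightarrow> coeff_tensor" where
  "aff clear l \<equiv> affine_layer clear n q (A l) (b l)"

abbreviation par :: "coeff_tensor list" where
  "par \<equiv> map (parallel_layer \<Phi> n q) S"

definition layers :: "bool \<Rightarrow> coeff_tensor list" where
  "layers clear = interleave (aff clear) par (L - 1) @ [aff clear L]"

lemma length_layers: "length (layers clear) = L + (L - 1) * length S"
  using pos by (simp add: layers_def)

lemma nth_layers_affine:
  assumes "l \<in> {1..L}"
  shows "layers clear ! ((l - 1) * (length S + 1)) = aff clear l"
proof (cases "l = L")
  case True
  then show ?thesis by (simp add: layers_def nth_append)
next
  case False
  then have l: "l - 1 < L - 1" "Suc (l - 1) = l" using assms by auto
  then have "(l - 1) * (length S + 1) < length (interleave (aff clear) par (L - 1))"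
    by (simp del: mult_Suc_right)
  then show ?thesis
    using nth_interleave_head[OF l(1), of "aff clear" par] l(2)
    by (simp add: layers_def nth_append del: mult_Suc_right)
qed

lemma nth_layers_parallel:
  assumes "l \<in> {1..<L}" "s < length S"
  shows "layers clear ! ((l - 1) * (length S + 1) + 1 + s) = parallel_layer \<Phi> n q (S ! s)"
proof -
  have l: "l - 1 < L - 1" using assms by auto
  then have "(l - 1) * (length S + 1) + 1 + s < length (interleave (aff clear) par (L - 1))"
    using block_coord_less[OF l, of "1 + s" "length S + 1"] assms by simp
  then show ?thesis
    using nth_interleave_tail[OF l, of s par "aff clear"] assms
    unfolding layers_def by (simp only: nth_append if_True length_map nth_map)
qed

lemma nn_dim_le: "nn_dim d n d\<^sub>o L l \<le> n"
  using width by (simp add: nn_dim_def)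

lemma affine_dims:
  assumes "l \<in> {1..L}"
  shows "dim_row (A l) \<le> n" "dim_col (A l) \<le> n" "dim_vec (b l) = dim_row (A l)"
  using A[OF assms] b[OF assms] nn_dim_le[of l] nn_dim_le[of "l - 1"] by auto

lemma encodes_affine_aff: "l \<in> {1..L} \<Longrightarrow> encodes_affine \<Phi> n q (aff clear l) (A l) (b l)"
  using encodes_affine_layer[OF basis pos(2) affine_dims] .

lemma total_params_layers:
  "total_params \<Phi> (n * q) (layers False) =
    (\<Sum>l=1..L-1. affine_params (A l) (b l)) + affine_params (A L) (b L)
      + (L - 1) * n * total_params \<Phi> q S"
proof -
  have aff: "num_params \<Phi> (n * q) (aff False l) = affine_params (A l) (b l)" if "l \<in> {1..L}" for l
    using num_params_affine_layer[OF basis(2) pos(2) affine_dims[OF that]] .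
  have par: "sum_list (map (num_params \<Phi> (n * q)) par) = n * total_params \<Phi> q S"
    by (simp add: total_params_def comp_def num_params_parallel_layer[OF basis pos(2)]
        sum_list_const_mult)
  have "sum_list (map (num_params \<Phi> (n * q)) (interleave (aff False) par l)) =
      (\<Sum>l=1..l. affine_params (A l) (b l)) + l * (n * total_params \<Phi> q S)" if "l \<le> L" for l
    using that by (induction l) (auto simp: aff par[unfolded map_map] algebra_simps)
  then show ?thesis
    using pos by (simp add: total_params_def layers_def aff mult.assoc)
qed

section \<open>Evaluation of the encoding along the network\<close>

definition act_input :: "real vec \<Rightarrow> nat \<Rightarrow> real vec" where
  "act_input x l = (if l = 0 then x else map_vec \<sigma> (dnn \<sigma> A b l x))"

lemma dnn_Suc: "dnn \<sigma> A b (Suc l) x = A (Suc l) *\<^sub>v act_input x l + b (Suc l)"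
  by (simp add: act_input_def)

lemma dnn_dim: "l \<in> {1..L} \<Longrightarrow> dim_vec (dnn \<sigma> A b l x) = nn_dim d n d\<^sub>o L l"
  using b[of l] by (cases l) auto

lemma act_input_dim:
  assumes "x \<in> carrier_vec d" "l < L"
  shows "act_input x l \<in> carrier_vec (nn_dim d n d\<^sub>o L l)"
proof (cases "l = 0")
  case True
  then show ?thesis using assms by (simp add: act_input_def nn_dim_def)
next
  case False
  then have "dim_vec (dnn \<sigma> A b l x) = nn_dim d n d\<^sub>o L l"
    using assms by (intro dnn_dim) auto
  then show ?thesis
    using False by (intro carrier_vecI) (simp add: act_input_def)
qed

text \<open>The zeros in \<open>act\<close> are those that \<open>encodes_affine\<close> demands for
  missing columns. They can occur only for \<open>l = 0\<close>, where the lift supplies them, since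
  later inputs have dimension \<open>n\<close>.\<close>

lemma affine_step:
  assumes y: "y \<in> carrier_vec (n * q)" and x: "x \<in> carrier_vec d" and l: "l < L"
    and act: "\<And>j. j < n \<Longrightarrow> y $ (j * q) = (if j < nn_dim d n d\<^sub>o L l then act_input x l $ j else 0)"
    and i: "i < nn_dim d n d\<^sub>o L (Suc l)"
  shows "(y + ct_layer \<Phi> (n * q) (aff clear (Suc l)) y) $ (i * q) = dnn \<sigma> A b (Suc l) x $ i"
proof -
  have Al: "A (Suc l) \<in> carrier_mat (nn_dim d n d\<^sub>o L (Suc l)) (nn_dim d n d\<^sub>o L l)"
    using A[of "Suc l"] l by simp
  have "vec (dim_col (A (Suc l))) (\<lambda>j. y $ (j * q)) = act_input x l"
    using Al act act_input_dim[OF x l] nn_dim_le[of l] by (intro eq_vecI) auto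
  moreover have "\<forall>j<n. dim_col (A (Suc l)) \<le> j \<longrightarrow> y $ (j * q) = 0"
    using act Al by auto
  ultimately show ?thesis
    using encodes_affine_aff[of "Suc l" clear] l y i Al
    unfolding encodes_affine_def dnn_Suc by auto
qed

text \<open>
  The history \<open>h i\<close> lists the inputs on which block \<open>i\<close> has run without a reset of its auxiliary
  coordinates; with \<open>clear\<close> this is at most the last input.
\<close>

lemma run_interleave:
  assumes restart: "restartable \<Phi> q S \<sigma> (if clear then 1 else L - 1)"
    and x: "x \<in> carrier_vec d" and "l < L"
  shows "\<exists>y h. ct_run \<Phi> (n * q) (interleave (aff clear) par l) (pair_lift n q d x) = y
    \<and> y \<in> carrier_vec (n * q)
    \<and> (\<forall>i<n. y $ (i * q) = (if i < nn_dim d n d\<^sub>o L l then act_input x l $ i else 0))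
    \<and> (\<forall>i<n. length (h i) \<le> l \<and> (\<forall>k<q. 0 < k \<longrightarrow> y $ (i * q + k) = restart \<Phi> q S (h i) $ k))"
  using assms(3)
proof (induction l)
  case 0
  have "pair_lift n q d x $ (i * q + k) = 0" if "i < n" "k < q" "0 < k" for i k
    using block_coord_less[OF that(1,2)] that by (simp add: pair_lift_def)
  moreover have "pair_lift n q d x $ (i * q) = (if i < d then x $ i else 0)" if "i < n" for i
    using that pos by (simp add: pair_lift_def)
  \<comment> \<open>No block has run yet: all histories are empty, and \<open>restart\<close> of the
    empty list is the zero vector.\<close>
  ultimately show ?case
    by (intro exI[of _ "pair_lift n q d x"] exI[of _ "\<lambda>_. []"])
      (auto simp: ct_run_def pair_lift_def nn_dim_def act_input_def restart_def)
next
  case (Suc l)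
  then obtain y h where run: "ct_run \<Phi> (n * q) (interleave (aff clear) par l) (pair_lift n q d x) = y"
    and y: "y \<in> carrier_vec (n * q)"
    and act: "\<forall>i<n. y $ (i * q) = (if i < nn_dim d n d\<^sub>o L l then act_input x l $ i else 0)"
    and hist: "\<forall>i<n. length (h i) \<le> l \<and> (\<forall>k<q. 0 < k \<longrightarrow> y $ (i * q + k) = restart \<Phi> q S (h i) $ k)"
    using Suc_lessD by blast
  define z where "z = y + ct_layer \<Phi> (n * q) (aff clear (Suc l)) y"
  define w where "w = ct_run \<Phi> (n * q) par z"
  \<comment> \<open>A resetting affine layer erases the history, as if no run had taken
    place.\<close>
  define h0 where "h0 i = (if clear then [] else h i)" for i
  define a where "a i = dnn \<sigma> A b (Suc l) x $ i" for i
  have z: "z \<in> carrier_vec (n * q)"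
    unfolding z_def using y ct_layer_carrier by simp
  \<comment> \<open>As \<open>Suc l < L\<close>, this affine map has \<open>n\<close> rows, so every
    block receives a value of the network.\<close>
  have dim: "nn_dim d n d\<^sub>o L (Suc l) = n"
    using Suc.prems by (simp add: nn_dim_def)
  have z_act: "z $ (i * q) = a i" if "i < n" for i
    unfolding z_def a_def using affine_step[OF y x Suc_lessD[OF Suc.prems] act[rule_format]] that dim by simp
  have z_aux: "z $ (i * q + k) = restart \<Phi> q S (h0 i) $ k" if "i < n" "k < q" "0 < k" for i k
    using affine_layer_aux[OF basis y block_coord_less[OF that(1,2)], of clear "A (Suc l)" "b (Suc l)"]
      hist that
    by (simp add: z_def h0_def restart_def)
  have "block q i w = restart \<Phi> q S (h0 i @ [a i])" if i: "i < n" for i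
  proof -
    have "block q i z = vec q (\<lambda>k. if k = 0 then a i else restart \<Phi> q S (h0 i) $ k)"
    proof (rule eq_vecI)
      fix k assume "k < dim_vec (vec q (\<lambda>k. if k = 0 then a i else restart \<Phi> q S (h0 i) $ k))"
      then show "block q i z $ k = vec q (\<lambda>k. if k = 0 then a i else restart \<Phi> q S (h0 i) $ k) $ k"
        using z_act[OF i] z_aux[OF i, of k] by (cases "k = 0") (simp_all add: block_def)
    qed (simp add: block_def)
    then show ?thesis
      unfolding w_def by (simp only: block_ct_run_parallel[OF basis pos(2) i z] restart_snoc)
  qed
  then have w_at: "w $ (i * q + k) = restart \<Phi> q S (h0 i @ [a i]) $ k" if "i < n" "k < q" for i k
    using that by (metis block_def index_vec)
  have "w $ (i * q) = act_input x (Suc l) $ i" if i: "i < n" for i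
  proof -
    have "length (h i) \<le> l" using hist i by blast
    \<comment> \<open>The new history has length 1 after a reset and otherwise at most
      \<open>l + 1\<close>, which is at most \<open>L - 1\<close>.\<close>
    then have "length (h0 i @ [a i]) \<le> (if clear then 1 else L - 1)"
      using Suc.prems by (cases clear) (auto simp: h0_def)
    then have "restart \<Phi> q S (h0 i @ [a i]) $ 0 = \<sigma> (last (h0 i @ [a i]))"
      using restart unfolding restartable_def by blast
    then show ?thesis
      using w_at[OF i pos(2)] i dnn_dim[of "Suc l" x] Suc.prems dim
      by (simp add: a_def act_input_def del: dnn.simps)
  qed
  moreover have "w \<in> carrier_vec (n * q)"
    unfolding w_def using z by (rule ct_run_carrier)
  moreover have "length (h0 i @ [a i]) \<le> Suc l" if "i < n" for i
    using hist that by (simp add: h0_def)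
  moreover have "ct_run \<Phi> (n * q) (interleave (aff clear) par (Suc l)) (pair_lift n q d x) = w"
    by (simp add: ct_run_append ct_run_Cons run z_def w_def)
  ultimately show ?case
    using w_at dim by (intro exI[of _ w] exI[of _ "\<lambda>i. h0 i @ [a i]"]) auto
qed

text \<open>After \<open>L - 1\<close> rounds one affine layer remains. It fixes the first
  \<open>d\<^sub>o\<close> blocks, the only ones that the retraction reads.\<close>

lemma compositional_tensor_layers:
  assumes "restartable \<Phi> q S \<sigma> (if clear then 1 else L - 1)"
  shows "compositional_tensor \<Phi> (n * q) (layers clear) (pair_lift n q d) (pair_retr q d\<^sub>o) d d\<^sub>o
    (dnn \<sigma> A b L)"
  unfolding compositional_tensor_def
proof (intro conjI ballI)
  fix x :: "real vec" assume x: "x \<in> carrier_vec d"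
  have L: "L - 1 < L" "Suc (L - 1) = L" using pos by auto
  obtain y where run: "ct_run \<Phi> (n * q) (interleave (aff clear) par (L - 1)) (pair_lift n q d x) = y"
    and y: "y \<in> carrier_vec (n * q)"
    and act: "\<And>i. i < n \<Longrightarrow>
      y $ (i * q) = (if i < nn_dim d n d\<^sub>o L (L - 1) then act_input x (L - 1) $ i else 0)"
    using run_interleave[OF assms x L(1)] by auto
  have dim: "nn_dim d n d\<^sub>o L L = d\<^sub>o" using pos by (simp add: nn_dim_def)
  have "(y + ct_layer \<Phi> (n * q) (aff clear L) y) $ (i * q) = dnn \<sigma> A b L x $ i" if "i < d\<^sub>o" for i
    using affine_step[OF y x L(1) act, of i clear] that dim L(2) by simp
  moreover have "ct_run \<Phi> (n * q) (layers clear) (pair_lift n q d x)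
      = y + ct_layer \<Phi> (n * q) (aff clear L) y"
    unfolding layers_def ct_run_append run by (simp add: ct_run_def)
  ultimately show "dnn \<sigma> A b L x = pair_retr q d\<^sub>o (ct_run \<Phi> (n * q) (layers clear) (pair_lift n q d x))"
    using dnn_dim[of L x] pos dim by (intro eq_vecI) (auto simp: pair_retr_def)
qed (use linear_pair_lift linear_pair_retr[OF width(2) pos(2)] in auto)

end

section \<open>Activations in the span of the basis\<close>

text \<open>At width 1 a multi-index is the choice of one basis function, so the basis itself labels
  the coefficients.\<close>

definition univariate_tensor ::
  "(real \<Rightarrow> real) set \<Rightarrow> ((real \<Rightarrow> real) \<Rightarrow> real) \<Rightarrow> coeff_tensor" where
  "univariate_tensor \<Phi> c = sparse_tensor \<Phi> (\<lambda>_ \<phi>. \<lambda>t\<in>{..<1}. \<phi>) (\<lambda>_. c)"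

lemma ct_layer_univariate_tensor:
  assumes "finite \<Phi>"
  shows "ct_layer \<Phi> 1 (univariate_tensor \<Phi> c) x = vec 1 (\<lambda>_. \<Sum>\<phi>\<in>\<Phi>. c \<phi> * \<phi> (x $ 0))"
  unfolding univariate_tensor_def
  by (subst ct_layer_sparse_tensor[OF assms assms]) (auto simp: multi_indices_def)

lemma num_params_univariate_tensor:
  assumes "finite \<Phi>"
  shows "num_params \<Phi> 1 (univariate_tensor \<Phi> c) = card {\<phi>\<in>\<Phi>. c \<phi> \<noteq> 0}"
proof -
  have "inj_on (\<lambda>\<phi>. \<lambda>t\<in>{..<1::nat}. \<phi>) \<Phi>"
    by (auto simp: inj_on_def fun_eq_iff restrict_def)
  then have "num_params \<Phi> 1 (univariate_tensor \<Phi> c) = card {(j::nat, \<phi>). j < 1 \<and> \<phi> \<in> \<Phi> \<and> c \<phi> \<noteq> 0}"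
    unfolding univariate_tensor_def
    by (intro num_params_sparse_tensor assms) (auto simp: multi_indices_def)
  also have "{(j::nat, \<phi>). j < 1 \<and> \<phi> \<in> \<Phi> \<and> c \<phi> \<noteq> 0} = {0} \<times> {\<phi>\<in>\<Phi>. c \<phi> \<noteq> 0}"
    by auto
  finally show ?thesis by (simp add: card_cartesian_product)
qed

text \<open>A layer is added to the identity, so it is \<sigma> - id that gets expanded. Expansions
  over \<Phi> need not be unique; if \<sigma> - id is a nonzero multiple of one basis function, the
  one-term expansion is chosen.\<close>

lemma residual_in_span:
  assumes "finite \<Phi>" "(\<lambda>t. t) \<in> \<Phi>" "\<sigma> \<in> fun_span \<Phi>"
  obtains c where "\<And>t. \<sigma> t = t + (\<Sum>\<phi>\<in>\<Phi>. c \<phi> * \<phi> t)"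
    and "(\<exists>\<phi>\<in>\<Phi>. \<exists>\<alpha>. \<alpha> \<noteq> 0 \<and> (\<forall>t. \<sigma> t = t + \<alpha> * \<phi> t)) \<Longrightarrow> card {\<phi>\<in>\<Phi>. c \<phi> \<noteq> 0} = 1"
proof -
  note pick = sum_single_coeff[OF assms(1)]
  show thesis
  proof (cases "\<exists>\<phi>\<in>\<Phi>. \<exists>\<alpha>. \<alpha> \<noteq> 0 \<and> (\<forall>t. \<sigma> t = t + \<alpha> * \<phi> t)")
    case True
    then obtain \<phi> \<alpha> where \<phi>: "\<phi> \<in> \<Phi>" "\<alpha> \<noteq> 0" "\<And>t. \<sigma> t = t + \<alpha> * \<phi> t" by blast
    then have "{\<psi>\<in>\<Phi>. (if \<psi> = \<phi> then \<alpha> else 0) \<noteq> 0} = {\<phi>}" by auto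
    then show thesis
      using that[of "\<lambda>\<psi>. if \<psi> = \<phi> then \<alpha> else 0"] \<phi> pick by simp
  next
    case False
    obtain c where c: "\<And>t. \<sigma> t = (\<Sum>\<phi>\<in>\<Phi>. c \<phi> * \<phi> t)"
      using assms(3) by (auto simp: fun_span_def)
    show thesis
    proof (rule that)
      show "\<sigma> t = t + (\<Sum>\<phi>\<in>\<Phi>. (c \<phi> - (if \<phi> = (\<lambda>t. t) then 1 else 0)) * \<phi> t)" for t
        by (simp add: left_diff_distrib sum_subtractf pick[OF assms(2)] flip: c)
    qed (use False in blast)
  qed
qed

lemma tt_bounded_cong:
  "(\<And>x. x \<in> carrier_vec p \<Longrightarrow> \<psi> x = \<psi>' x) \<Longrightarrow> tt_bounded \<Phi> p r \<psi> = tt_bounded \<Phi> p r \<psi>'"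
  by (simp add: tt_bounded_def)

text \<open>With blocks of size 1 the layer is additive with zero bias and the identity matrix as
  \<open>W\<close>, so the bound holds across all coordinates and not just within blocks.\<close>

lemma tt_bounded_parallel_univariate:
  assumes "finite \<Phi>" "{\<lambda>_. 1, \<lambda>t. t} \<subseteq> \<Phi>" "0 < n"
  shows "tt_bounded \<Phi> n (n # replicate (n - 1) n)
    (ct_layer \<Phi> n (parallel_layer \<Phi> n 1 (univariate_tensor \<Phi> c)))"
proof -
  let ?g = "\<lambda>t. \<Sum>\<phi>\<in>\<Phi>. c \<phi> * \<phi> t"
  have "ct_layer \<Phi> n (parallel_layer \<Phi> n 1 (univariate_tensor \<Phi> c)) x
      = vec n (\<lambda>a. 0 + (\<Sum>j<n. (if j = a then 1 else 0) * ?g (x $ (j * 1))))"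
    if x: "x \<in> carrier_vec n" for x
  proof (rule eq_vecI)
    fix i assume "i < dim_vec (vec n (\<lambda>a. 0 + (\<Sum>j<n. (if j = a then 1 else 0) * ?g (x $ (j * 1)))))"
    then have i: "i < n" by simp
    have "block 1 i (ct_layer \<Phi> n (parallel_layer \<Phi> n 1 (univariate_tensor \<Phi> c)) x)
        = ct_layer \<Phi> 1 (univariate_tensor \<Phi> c) (block 1 i x)"
      using encodes_parallel_layer[OF assms(1,2), of 1 n "univariate_tensor \<Phi> c"] x i
      by (simp add: encodes_parallel_def)
    then have "ct_layer \<Phi> n (parallel_layer \<Phi> n 1 (univariate_tensor \<Phi> c)) x $ i = ?g (x $ i)"
      unfolding ct_layer_univariate_tensor[OF assms(1)] block_def
      by (auto dest!: arg_cong[where f = "\<lambda>v. v $ 0"])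
    also have "\<dots> = (\<Sum>j<n. if j = i then ?g (x $ j) else 0)"
      using i by simp
    also have "\<dots> = (\<Sum>j<n. (if j = i then 1 else 0) * ?g (x $ j))"
      by (intro sum.cong) auto
    finally show "ct_layer \<Phi> n (parallel_layer \<Phi> n 1 (univariate_tensor \<Phi> c)) x $ i
        = vec n (\<lambda>a. 0 + (\<Sum>j<n. (if j = a then 1 else 0) * ?g (x $ (j * 1)))) $ i"
      using i by simp
  qed (simp add: ct_layer_def)
  moreover have "?g \<in> fun_span \<Phi>"
    unfolding fun_span_def by blast
  ultimately show ?thesis
    using tt_bounded_additive[where g = ?g and \<Phi> = \<Phi> and n = n and q = 1 and c = "\<lambda>_. 0"
        and W = "\<lambda>a j. if j = a then 1 else 0"] assms
    by (subst tt_bounded_cong) auto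
qed

text \<open>Because layers are residual, one layer of width 1 with a single parameter computes
  \<sigma> exactly if \<sigma> - id is a nonzero multiple of a basis function; hence the premise of
  that count.\<close>

theorem theorem3p10:
  fixes \<Phi> :: "(real \<Rightarrow> real) set" and \<sigma> :: "real \<Rightarrow> real"
    and L\<^sub>\<sigma> p\<^sub>\<sigma> m\<^sub>\<sigma> L p\<^sub>f d d\<^sub>o :: nat
    and C\<^sub>\<sigma> :: "coeff_tensor list"
    and A :: "nat \<Rightarrow> real mat" and b :: "nat \<Rightarrow> real vec"
  assumes basis: "finite \<Phi>" "{\<lambda>_. 1, \<lambda>t. t} \<subseteq> \<Phi>"
    and sigma_rep: "0 < p\<^sub>\<sigma>"
      "compositional_tensor \<Phi> p\<^sub>\<sigma> C\<^sub>\<sigma> (act_lift p\<^sub>\<sigma>) act_retr 1 1 (map_vec \<sigma>)"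
      "length C\<^sub>\<sigma> = L\<^sub>\<sigma>" "total_params \<Phi> p\<^sub>\<sigma> C\<^sub>\<sigma> = m\<^sub>\<sigma>"
    and dims: "1 \<le> L" "0 < p\<^sub>f" "d \<le> p\<^sub>f" "d\<^sub>o \<le> p\<^sub>f"
    and A: "\<And>l. l \<in> {1..L} \<Longrightarrow> A l \<in> carrier_mat (nn_dim d p\<^sub>f d\<^sub>o L l) (nn_dim d p\<^sub>f d\<^sub>o L (l - 1))"
    and b: "\<And>l. l \<in> {1..L} \<Longrightarrow> b l \<in> carrier_vec (nn_dim d p\<^sub>f d\<^sub>o L l)"
  shows
    "(\<exists>Cs. length Cs = L + (L - 1) * L\<^sub>\<sigma>
        \<and> compositional_tensor \<Phi> (p\<^sub>f * p\<^sub>\<sigma>) Cs (pair_lift p\<^sub>f p\<^sub>\<sigma> d) (pair_retr p\<^sub>\<sigma> d\<^sub>o) d d\<^sub>o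
            (dnn \<sigma> A b L)
        \<and> (\<forall>l\<in>{1..L}. encodes_affine \<Phi> p\<^sub>f p\<^sub>\<sigma> (Cs ! ((l - 1) * (L\<^sub>\<sigma> + 1))) (A l) (b l))
        \<and> (\<forall>l\<in>{1..<L}. \<forall>s<L\<^sub>\<sigma>.
              encodes_parallel \<Phi> p\<^sub>f p\<^sub>\<sigma> (Cs ! ((l - 1) * (L\<^sub>\<sigma> + 1) + 1 + s)) (C\<^sub>\<sigma> ! s))
        \<and> (restartable \<Phi> p\<^sub>\<sigma> C\<^sub>\<sigma> \<sigma> (L - 1) \<longrightarrow>
              total_params \<Phi> (p\<^sub>f * p\<^sub>\<sigma>) Cs =
                (\<Sum>l=1..L-1. affine_params (A l) (b l)) + affine_params (A L) (b L)
                  + (L - 1) * p\<^sub>f * m\<^sub>\<sigma>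
            \<and> (\<forall>l\<in>{1..L}. tt_bounded \<Phi> (p\<^sub>f * p\<^sub>\<sigma>)
                  (p\<^sub>f * p\<^sub>\<sigma> # replicate (p\<^sub>f * p\<^sub>\<sigma> - 1) p\<^sub>f)
                  (ct_layer \<Phi> (p\<^sub>f * p\<^sub>\<sigma>) (Cs ! ((l - 1) * (L\<^sub>\<sigma> + 1))))))
        \<and> (\<forall>r\<^sub>\<sigma>. (\<forall>s<L\<^sub>\<sigma>. tt_bounded \<Phi> p\<^sub>\<sigma> r\<^sub>\<sigma> (ct_layer \<Phi> p\<^sub>\<sigma> (C\<^sub>\<sigma> ! s))) \<longrightarrow>
              (\<forall>l\<in>{1..<L}. \<forall>s<L\<^sub>\<sigma>. block_tt_bounded \<Phi> p\<^sub>f p\<^sub>\<sigma> r\<^sub>\<sigma>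
                  (ct_layer \<Phi> (p\<^sub>f * p\<^sub>\<sigma>) (Cs ! ((l - 1) * (L\<^sub>\<sigma> + 1) + 1 + s))))))
     \<and> (\<sigma> \<in> fun_span \<Phi> \<longrightarrow>
        (\<exists>C. compositional_tensor \<Phi> 1 [C] (\<lambda>x. x) act_retr 1 1 (map_vec \<sigma>)
           \<and> ((\<exists>\<phi>\<in>\<Phi>. \<exists>c. c \<noteq> 0 \<and> (\<forall>t. \<sigma> t = t + c * \<phi> t)) \<longrightarrow> total_params \<Phi> 1 [C] = 1)
           \<and> (\<exists>Cs. length Cs = 2 * L - 1
                \<and> compositional_tensor \<Phi> p\<^sub>f Cs (pair_lift p\<^sub>f 1 d) (pair_retr 1 d\<^sub>o) d d\<^sub>o
                    (dnn \<sigma> A b L)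
                \<and> total_params \<Phi> p\<^sub>f Cs =
                    (\<Sum>l=1..L-1. affine_params (A l) (b l)) + affine_params (A L) (b L)
                      + (L - 1) * p\<^sub>f * total_params \<Phi> 1 [C]
                \<and> (\<forall>s<2 * L - 1. tt_bounded \<Phi> p\<^sub>f (p\<^sub>f # replicate (p\<^sub>f - 1) p\<^sub>f)
                    (ct_layer \<Phi> p\<^sub>f (Cs ! s))))))"
proof (intro conjI impI)
  interpret E: network_encoding \<Phi> \<sigma> p\<^sub>f p\<^sub>\<sigma> L d d\<^sub>o C\<^sub>\<sigma> A b
    using assms by unfold_locales auto
  \<comment> \<open>Resets are used just when the tensor cannot be restarted, so one list of layers
    serves both cases; after a reset single runs suffice.\<close>
  define clear where "clear \<longleftrightarrow> \<not> restartable \<Phi> p\<^sub>\<sigma> C\<^sub>\<sigma> \<sigma> (L - 1)"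
  have restart: "restartable \<Phi> p\<^sub>\<sigma> C\<^sub>\<sigma> \<sigma> (if clear then 1 else L - 1)"
    using restartable_one[OF sigma_rep(2)] by (simp add: clear_def)
  note head = E.nth_layers_affine[of _ clear, unfolded sigma_rep(3)]
  note tail = E.nth_layers_parallel[of _ _ clear, unfolded sigma_rep(3)]
  show "\<exists>Cs. length Cs = L + (L - 1) * L\<^sub>\<sigma>
        \<and> compositional_tensor \<Phi> (p\<^sub>f * p\<^sub>\<sigma>) Cs (pair_lift p\<^sub>f p\<^sub>\<sigma> d) (pair_retr p\<^sub>\<sigma> d\<^sub>o) d d\<^sub>o
            (dnn \<sigma> A b L)
        \<and> (\<forall>l\<in>{1..L}. encodes_affine \<Phi> p\<^sub>f p\<^sub>\<sigma> (Cs ! ((l - 1) * (L\<^sub>\<sigma> + 1))) (A l) (b l))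
        \<and> (\<forall>l\<in>{1..<L}. \<forall>s<L\<^sub>\<sigma>.
              encodes_parallel \<Phi> p\<^sub>f p\<^sub>\<sigma> (Cs ! ((l - 1) * (L\<^sub>\<sigma> + 1) + 1 + s)) (C\<^sub>\<sigma> ! s))
        \<and> (restartable \<Phi> p\<^sub>\<sigma> C\<^sub>\<sigma> \<sigma> (L - 1) \<longrightarrow>
              total_params \<Phi> (p\<^sub>f * p\<^sub>\<sigma>) Cs =
                (\<Sum>l=1..L-1. affine_params (A l) (b l)) + affine_params (A L) (b L)
                  + (L - 1) * p\<^sub>f * m\<^sub>\<sigma>
            \<and> (\<forall>l\<in>{1..L}. tt_bounded \<Phi> (p\<^sub>f * p\<^sub>\<sigma>)
                  (p\<^sub>f * p\<^sub>\<sigma> # replicate (p\<^sub>f * p\<^sub>\<sigma> - 1) p\<^sub>f)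
                  (ct_layer \<Phi> (p\<^sub>f * p\<^sub>\<sigma>) (Cs ! ((l - 1) * (L\<^sub>\<sigma> + 1))))))
        \<and> (\<forall>r\<^sub>\<sigma>. (\<forall>s<L\<^sub>\<sigma>. tt_bounded \<Phi> p\<^sub>\<sigma> r\<^sub>\<sigma> (ct_layer \<Phi> p\<^sub>\<sigma> (C\<^sub>\<sigma> ! s))) \<longrightarrow>
              (\<forall>l\<in>{1..<L}. \<forall>s<L\<^sub>\<sigma>. block_tt_bounded \<Phi> p\<^sub>f p\<^sub>\<sigma> r\<^sub>\<sigma>
                  (ct_layer \<Phi> (p\<^sub>f * p\<^sub>\<sigma>) (Cs ! ((l - 1) * (L\<^sub>\<sigma> + 1) + 1 + s)))))"
  proof (intro exI[of _ "E.layers clear"] conjI ballI allI impI)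
    show "length (E.layers clear) = L + (L - 1) * L\<^sub>\<sigma>"
      using E.length_layers sigma_rep(3) by simp
    show "compositional_tensor \<Phi> (p\<^sub>f * p\<^sub>\<sigma>) (E.layers clear) (pair_lift p\<^sub>f p\<^sub>\<sigma> d) (pair_retr p\<^sub>\<sigma> d\<^sub>o)
        d d\<^sub>o (dnn \<sigma> A b L)"
      by (rule E.compositional_tensor_layers[OF restart])
  next
    fix l assume "l \<in> {1..L}"
    then show "encodes_affine \<Phi> p\<^sub>f p\<^sub>\<sigma> (E.layers clear ! ((l - 1) * (L\<^sub>\<sigma> + 1))) (A l) (b l)"
      unfolding head[OF \<open>l \<in> {1..L}\<close>] by (rule E.encodes_affine_aff)
  next
    fix l s assume "l \<in> {1..<L}" "s < L\<^sub>\<sigma>"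
    then show "encodes_parallel \<Phi> p\<^sub>f p\<^sub>\<sigma> (E.layers clear ! ((l - 1) * (L\<^sub>\<sigma> + 1) + 1 + s)) (C\<^sub>\<sigma> ! s)"
      by (subst tail) (auto intro: encodes_parallel_layer[OF basis sigma_rep(1)])
  next
    assume "restartable \<Phi> p\<^sub>\<sigma> C\<^sub>\<sigma> \<sigma> (L - 1)"
    then have clear: "clear = False" by (simp add: clear_def)
    show "total_params \<Phi> (p\<^sub>f * p\<^sub>\<sigma>) (E.layers clear) =
        (\<Sum>l=1..L-1. affine_params (A l) (b l)) + affine_params (A L) (b L) + (L - 1) * p\<^sub>f * m\<^sub>\<sigma>"
      unfolding clear using E.total_params_layers sigma_rep(4) by simp
    fix l assume "l \<in> {1..L}"
    then show "tt_bounded \<Phi> (p\<^sub>f * p\<^sub>\<sigma>) (p\<^sub>f * p\<^sub>\<sigma> # replicate (p\<^sub>f * p\<^sub>\<sigma> - 1) p\<^sub>f)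
        (ct_layer \<Phi> (p\<^sub>f * p\<^sub>\<sigma>) (E.layers clear ! ((l - 1) * (L\<^sub>\<sigma> + 1))))"
      unfolding head[OF \<open>l \<in> {1..L}\<close>] unfolding clear
      by (intro tt_bounded_affine_layer basis dims sigma_rep)
  next
    fix r l s
    assume "\<forall>s<L\<^sub>\<sigma>. tt_bounded \<Phi> p\<^sub>\<sigma> r (ct_layer \<Phi> p\<^sub>\<sigma> (C\<^sub>\<sigma> ! s))" "l \<in> {1..<L}" "s < L\<^sub>\<sigma>"
    then show "block_tt_bounded \<Phi> p\<^sub>f p\<^sub>\<sigma> r
        (ct_layer \<Phi> (p\<^sub>f * p\<^sub>\<sigma>) (E.layers clear ! ((l - 1) * (L\<^sub>\<sigma> + 1) + 1 + s)))"
      by (subst tail) (auto intro: block_tt_bounded_parallel_layer[OF basis sigma_rep(1)])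
  qed
next
  assume "\<sigma> \<in> fun_span \<Phi>"
  then obtain c where c: "\<And>t. \<sigma> t = t + (\<Sum>\<phi>\<in>\<Phi>. c \<phi> * \<phi> t)"
    and card_c: "(\<exists>\<phi>\<in>\<Phi>. \<exists>\<alpha>. \<alpha> \<noteq> 0 \<and> (\<forall>t. \<sigma> t = t + \<alpha> * \<phi> t)) \<Longrightarrow> card {\<phi>\<in>\<Phi>. c \<phi> \<noteq> 0} = 1"
    using residual_in_span[of \<Phi> \<sigma>] basis by auto
  define C where "C = univariate_tensor \<Phi> c"
  have run: "ct_run \<Phi> 1 [C] x $ 0 = \<sigma> (x $ 0)" for x
    by (simp add: ct_run_def C_def ct_layer_univariate_tensor[OF basis(1)] c
        del: One_nat_def)
  interpret E: network_encoding \<Phi> \<sigma> p\<^sub>f 1 L d d\<^sub>o "[C]" A b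
    using assms by unfold_locales auto
  \<comment> \<open>Width 1 leaves no auxiliary coordinates, so a run depends on its last input
    only.\<close>
  have "restartable \<Phi> 1 [C] \<sigma> (L - 1)"
    unfolding restartable_def
  proof (intro allI impI)
    fix xs :: "real list" assume "xs \<noteq> [] \<and> length xs \<le> L - 1"
    then obtain ys z where xs: "xs = ys @ [z]" by (metis rev_exhaust)
    show "restart \<Phi> 1 [C] xs $ 0 = \<sigma> (last xs)"
      unfolding xs restart_snoc run by simp
  qed
  then have comp: "compositional_tensor \<Phi> p\<^sub>f (E.layers False) (pair_lift p\<^sub>f 1 d) (pair_retr 1 d\<^sub>o)
      d d\<^sub>o (dnn \<sigma> A b L)"
    using E.compositional_tensor_layers[of False] by simp
  show "\<exists>C. compositional_tensor \<Phi> 1 [C] (\<lambda>x. x) act_retr 1 1 (map_vec \<sigma>)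
           \<and> ((\<exists>\<phi>\<in>\<Phi>. \<exists>c. c \<noteq> 0 \<and> (\<forall>t. \<sigma> t = t + c * \<phi> t)) \<longrightarrow> total_params \<Phi> 1 [C] = 1)
           \<and> (\<exists>Cs. length Cs = 2 * L - 1
                \<and> compositional_tensor \<Phi> p\<^sub>f Cs (pair_lift p\<^sub>f 1 d) (pair_retr 1 d\<^sub>o) d d\<^sub>o
                    (dnn \<sigma> A b L)
                \<and> total_params \<Phi> p\<^sub>f Cs =
                    (\<Sum>l=1..L-1. affine_params (A l) (b l)) + affine_params (A L) (b L)
                      + (L - 1) * p\<^sub>f * total_params \<Phi> 1 [C]
                \<and> (\<forall>s<2 * L - 1. tt_bounded \<Phi> p\<^sub>f (p\<^sub>f # replicate (p\<^sub>f - 1) p\<^sub>f)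
                    (ct_layer \<Phi> p\<^sub>f (Cs ! s))))"
  proof (intro exI[of _ C] exI[of _ "E.layers False"] conjI impI allI)
    show "compositional_tensor \<Phi> 1 [C] (\<lambda>x. x) act_retr 1 1 (map_vec \<sigma>)"
      unfolding compositional_tensor_def
    proof (intro conjI ballI)
      show "linear_vec_map 1 1 act_retr"
        by (auto simp: linear_vec_map_def act_retr_def intro!: eq_vecI)
      show "map_vec \<sigma> x = act_retr (ct_run \<Phi> 1 [C] x)" if "x \<in> carrier_vec 1" for x
        using that by (intro eq_vecI) (auto simp: act_retr_def run[unfolded One_nat_def])
    qed (simp add: linear_vec_map_def)
  next
    assume "\<exists>\<phi>\<in>\<Phi>. \<exists>c. c \<noteq> 0 \<and> (\<forall>t. \<sigma> t = t + c * \<phi> t)"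
    then show "total_params \<Phi> 1 [C] = 1"
      using card_c num_params_univariate_tensor[OF basis(1), of c]
      by (simp add: total_params_def C_def)
  next
    show "length (E.layers False) = 2 * L - 1"
      using E.length_layers[of False] dims(1) by simp
    show "total_params \<Phi> p\<^sub>f (E.layers False) =
        (\<Sum>l=1..L-1. affine_params (A l) (b l)) + affine_params (A L) (b L)
          + (L - 1) * p\<^sub>f * total_params \<Phi> 1 [C]"
      using E.total_params_layers by simp
  next
    fix s assume s: "s < 2 * L - 1"
    \<comment> \<open>The period is 2: even positions hold affine layer \<open>l\<close>, odd ones
      the copies of \<open>C\<close> that follow it.\<close>
    define l where "l = s div 2 + 1"
    show "tt_bounded \<Phi> p\<^sub>f (p\<^sub>f # replicate (p\<^sub>f - 1) p\<^sub>f) (ct_layer \<Phi> p\<^sub>f (E.layers False ! s))"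
    proof (cases "even s")
      case True
      then have "l \<in> {1..L}" "s = (l - 1) * (length [C] + 1)"
        using s by (auto simp: l_def)
      then show ?thesis
        using E.nth_layers_affine[of l False]
          tt_bounded_affine_layer[OF basis dims(2), of 1 "A l" "b l"] by simp
    next
      case False
      then have "l \<in> {1..<L}" "s = (l - 1) * (length [C] + 1) + 1 + 0"
        using s by (auto simp: l_def elim!: oddE)
      then show ?thesis
        using E.nth_layers_parallel[of l 0 False]
          tt_bounded_parallel_univariate[OF basis dims(2), of c] by (simp add: C_def)
    qed
  qed (rule comp)
qed

end
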